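(* Let $R$ be an associative ring with identity, $\Sigma$ a multiplicative set of square matrices over $R$, $X$ a unital left $R$-module, and $x \in X$. Let $\mu_X : X \rightarrow \Sigma^{-1}X$ be the canonical mapping defined by $\mu_X(x) = [1:1:x]$. The following conditions are equivalent: (1) $x \in \ker(\mu_X)$; (2) there exist $a \in R^n$, $z \in X^n$, and $C, D \in \Sigma_n$, for some $n > 0$, such that $$(1,1,0) + (0,D,z^t) \geq (1,1,x) + (a,C,0^t);$$ (3) there exist relations of the form $$\left[\begin{array}{c} x \\ 0^t \end{array}\right] = \left[\begin{array}{cc} a_{11} & a_{12} \\ C & A \end{array}\right]\left[\begin{array}{c} y^t \\ z^t \end{array}\right] \quad\text{and}\quad \left[\begin{array}{cc} a_{11} & a_{12} \\ C & A \end{array}\right]\left[\begin{array}{c} B \\ D \end{array}\right] = \left[\begin{array}{c} 0 \\ 0 \end{array}\right]$$ for (row) vectors $a_{11}, a_{12}$ over $R$, vectors $y, z$ over $X$, and matrices $A, B, C, D$ over $R$ such that $C, D \in \Sigma$ (with compatible sizes: for some positive integers $n,m$, $C \in \Sigma_n$, $D\in\Sigma_m$, $A,B$ are $n\times m$, $a_{11}\in R^n$, $a_{12}\in R^m$, $y\in X^n$, $z\in X^m$).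
   Context: $R$ is an associative ring with identity $1$, not necessarily commutative; $X$ is a unital left $R$-module. Elements of $R^n$ and $X^n$ are row vectors, and $x^t$ denotes the transpose (column vector). A set $\Sigma$ of square matrices over $R$ is multiplicative if it contains all permutation matrices over $R$ (of every size, in particular all identity matrices), is closed under multiplication (when defined), and whenever $C,D \in \Sigma$ then $\left[\begin{array}{cc} C & A \\ 0 & D \end{array}\right] \in \Sigma$ for any matrix $A$ over $R$ of the appropriate size. $\Sigma_n$ denotes the set of $n\times n$ matrices in $\Sigma$. A triple is an ordered triple $(a,C,x^t)$ with $a \in R^n$, $C \in \Sigma_n$, $x \in X^n$ for some positive integer $n$ (different triples may have different $n$). The sum of triples is $$(a,C,x^t)+(b,D,y^t) = \left([a\;\; b], \left[\begin{array}{cc} C & 0 \\ 0 & D\end{array}\right], \left[\begin{array}{c} x^t \\ y^t\end{array}\right]\right).$$ In a triple such as $(1,1,x)$ with $x\in X$, one has $n=1$ and the middle entry is the $1\times1$ identity matrix. Congruence: for $a,b\in R^n$, $C_1,C_2\in\Sigma_n$, $x,y\in X^n$, write $(a,C_1,x^t)\equiv(b,C_2,y^t)$ if there exist invertible $n\times n$ matrices $U_1,U_2$ over $R$ with $a=bU_1$, $y^t=U_2x^t$, and $C_2U_1=U_2C_1$. Addition of triples is commutative up to $\equiv$. $\Sigma^{-1}X_0$ is the subsemigroup generated by all triples of the form $(0,C,x^t)$ or $(b,D,0^t)$; up to $\equiv$ its elements can be put in the form $(0,C,x^t)+(b,D,0^t)$. Equivalence: $(a,C,x^t)\sim(b,D,y^t)$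 means that there exist $z_1,z_2\in\Sigma^{-1}X_0$ such that $(a,C,x^t)+z_1\equiv(b,D,y^t)+z_2$. This is an equivalence relation compatible with addition; $[a:C:x^t]$ denotes the class of $(a,C,x^t)$, and $\Sigma^{-1}X$ denotes the set of all classes. It is known that $\Sigma^{-1}X$ is an abelian group under the induced addition, whose zero element is the class of $(1,1,0)$ (equivalently of any element of $\Sigma^{-1}X_0$), and that it is naturally isomorphic to $R_\Sigma\otimes_R X$, where $R_\Sigma$ is Cohn's universal localization of $R$ at $\Sigma$. $\ker(\mu_X)$ is the set of $x\in X$ with $[1:1:x]$ equal to zero in $\Sigma^{-1}X$. The relation $\geq$: for $a\in R^n$, $C_1\in\Sigma_n$, $x\in X^n$ and $b\in R^m$, $C_2\in\Sigma_m$, $y\in X^m$, write $(a,C_1,x^t)\geq(b,C_2,y^t)$ if there exist $m\times n$ matrices $A_1,A_2$ over $R$ such that $a=bA_1$, $y^t=A_2x^t$, and $C_2A_1=A_2C_1$. *)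

theory Defs
  imports "Jordan_Normal_Form.Matrix" "HOL-Combinatorics.Permutations"
begin

text \<open>
  Rings are types of sort \<open>{ring, monoid_mult}\<close>: associative, with identity, not necessarily
  commutative. Unlike \<open>ring_1\<close>, this sort admits the zero ring. The distribution's module locales
  require a commutative ring, hence the locale below.
\<close>

locale left_module =
  fixes scale :: "'r::{ring,monoid_mult} \<Rightarrow> 'x::ab_group_add \<Rightarrow> 'x"
  assumes scale_right_distrib: "scale r (x + y) = scale r x + scale r y"
    and scale_left_distrib: "scale (r + s) x = scale r x + scale s x"
    and scale_scale: "scale r (scale s x) = scale (r * s) x"
    and scale_one: "scale 1 x = x"

text \<open>
  An element of \<open>R\<^sup>n\<close> is represented as a \<open>1 \<times> n\<close> matrix, so that \<open>b * U\<close> is the product of a row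
  vector with a matrix, with the factors in the right order. A column \<open>x\<^sup>t\<close> over the module is a
  \<^typ>\<open>'x vec\<close>.
\<close>

definition mat_act :: "('r \<Rightarrow> 'x \<Rightarrow> 'x) \<Rightarrow> 'r mat \<Rightarrow> 'x::comm_monoid_add vec \<Rightarrow> 'x vec" where
  "mat_act scale A v =
     vec (dim_row A) (\<lambda>i. \<Sum>j<dim_col A. scale (A $$ (i, j)) (v $ j))"

definition append_cols :: "'a::zero mat \<Rightarrow> 'a mat \<Rightarrow> 'a mat" where
  "append_cols A B = four_block_mat A B (0\<^sub>m 0 (dim_col A)) (0\<^sub>m 0 (dim_col B))"

definition permutation_mat :: "nat \<Rightarrow> (nat \<Rightarrow> nat) \<Rightarrow> 'r::{zero,one} mat" where
  "permutation_mat n p = mat n n (\<lambda>(i, j). if i = p j then 1 else 0)"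

text \<open>
  The library has \<open>0 \<times> 0\<close> matrices; members of a multiplicative set have positive size.
\<close>

definition multiplicative :: "'r::{ring,monoid_mult} mat set \<Rightarrow> bool" where
  "multiplicative \<Sigma> \<longleftrightarrow>
     (\<forall>C\<in>\<Sigma>. \<exists>n>0. C \<in> carrier_mat n n) \<and>
     (\<forall>n>0. \<forall>p. p permutes {..<n} \<longrightarrow> permutation_mat n p \<in> \<Sigma>) \<and>
     (\<forall>C\<in>\<Sigma>. \<forall>D\<in>\<Sigma>. dim_col C = dim_row D \<longrightarrow> C * D \<in> \<Sigma>) \<and>
     (\<forall>C\<in>\<Sigma>. \<forall>D\<in>\<Sigma>. \<forall>A\<in>carrier_mat (dim_row C) (dim_col D).
        four_block_mat C A (0\<^sub>m (dim_row D) (dim_col C)) D \<in> \<Sigma>)"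

type_synonym ('r, 'x) triple = "'r mat \<times> 'r mat \<times> 'x vec"

definition triples_dim :: "'r mat set \<Rightarrow> nat \<Rightarrow> ('r, 'x) triple set" where
  "triples_dim \<Sigma> n =
     {(a, C, x). a \<in> carrier_mat 1 n \<and> C \<in> \<Sigma> \<and> C \<in> carrier_mat n n \<and> x \<in> carrier_vec n}"

definition triples :: "'r mat set \<Rightarrow> ('r, 'x) triple set" where
  "triples \<Sigma> = (\<Union>n\<in>{0<..}. triples_dim \<Sigma> n)"

fun triple_add :: "('r::zero, 'x) triple \<Rightarrow> ('r, 'x) triple \<Rightarrow> ('r, 'x) triple" where
  "triple_add (a, C, x) (b, D, y) =
     (append_cols a b,
      four_block_mat C (0\<^sub>m (dim_row C) (dim_col D)) (0\<^sub>m (dim_row D) (dim_col C)) D,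
      x @\<^sub>v y)"

definition one_triple :: "'x \<Rightarrow> ('r::{zero,one}, 'x) triple" where
  "one_triple x = (1\<^sub>m 1, 1\<^sub>m 1, vec 1 (\<lambda>_. x))"

text \<open>
  Invertibility is written out because the library's \<open>invertible_mat\<close> excludes the zero ring.
\<close>

fun triple_cong :: "('r::{ring,monoid_mult} \<Rightarrow> 'x::ab_group_add \<Rightarrow> 'x) \<Rightarrow> 'r mat set \<Rightarrow>
    ('r, 'x) triple \<Rightarrow> ('r, 'x) triple \<Rightarrow> bool" where
  "triple_cong scale \<Sigma> (a, C\<^sub>1, x) (b, C\<^sub>2, y) \<longleftrightarrow>
     (\<exists>n>0. (a, C\<^sub>1, x) \<in> triples_dim \<Sigma> n \<and> (b, C\<^sub>2, y) \<in> triples_dim \<Sigma> n \<and>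
       (\<exists>U\<^sub>1\<in>carrier_mat n n. \<exists>U\<^sub>2\<in>carrier_mat n n.
          (\<exists>V\<in>carrier_mat n n. U\<^sub>1 * V = 1\<^sub>m n \<and> V * U\<^sub>1 = 1\<^sub>m n) \<and>
          (\<exists>V\<in>carrier_mat n n. U\<^sub>2 * V = 1\<^sub>m n \<and> V * U\<^sub>2 = 1\<^sub>m n) \<and>
          a = b * U\<^sub>1 \<and> y = mat_act scale U\<^sub>2 x \<and> C\<^sub>2 * U\<^sub>1 = U\<^sub>2 * C\<^sub>1))"

fun triple_ge :: "('r::{ring,monoid_mult} \<Rightarrow> 'x::ab_group_add \<Rightarrow> 'x) \<Rightarrow> 'r mat set \<Rightarrow>
    ('r, 'x) triple \<Rightarrow> ('r, 'x) triple \<Rightarrow> bool" where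
  "triple_ge scale \<Sigma> (a, C\<^sub>1, x) (b, C\<^sub>2, y) \<longleftrightarrow>
     (\<exists>n>0. \<exists>m>0. (a, C\<^sub>1, x) \<in> triples_dim \<Sigma> n \<and> (b, C\<^sub>2, y) \<in> triples_dim \<Sigma> m \<and>
       (\<exists>A\<^sub>1\<in>carrier_mat m n. \<exists>A\<^sub>2\<in>carrier_mat m n.
          a = b * A\<^sub>1 \<and> y = mat_act scale A\<^sub>2 x \<and> C\<^sub>2 * A\<^sub>1 = A\<^sub>2 * C\<^sub>1))"

definition null_generators :: "'r::zero mat set \<Rightarrow> ('r, 'x::zero) triple set" where
  "null_generators \<Sigma> =
     (\<Union>n\<in>{0<..}. {(a, C, x) \<in> triples_dim \<Sigma> n. a = 0\<^sub>m 1 n \<or> x = 0\<^sub>v n})"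

text \<open>The subsemigroup \<open>\<Sigma>\<^sup>-\<^sup>1X\<^sub>0\<close> of triples.\<close>

inductive_set null_triples :: "'r::zero mat set \<Rightarrow> ('r, 'x::zero) triple set"
  for \<Sigma> :: "'r::zero mat set" where
  generator: "t \<in> null_generators \<Sigma> \<Longrightarrow> t \<in> null_triples \<Sigma>"
| add: "s \<in> null_triples \<Sigma> \<Longrightarrow> t \<in> null_triples \<Sigma> \<Longrightarrow> triple_add s t \<in> null_triples \<Sigma>"

definition triple_equiv :: "('r::{ring,monoid_mult} \<Rightarrow> 'x::ab_group_add \<Rightarrow> 'x) \<Rightarrow> 'r mat set \<Rightarrow>
    (('r, 'x) triple \<times> ('r, 'x) triple) set" where
  "triple_equiv scale \<Sigma> =
     {(s, t). s \<in> triples \<Sigma> \<and> t \<in> triples \<Sigma> \<and>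
        (\<exists>z\<^sub>1\<in>null_triples \<Sigma>. \<exists>z\<^sub>2\<in>null_triples \<Sigma>.
           triple_cong scale \<Sigma> (triple_add s z\<^sub>1) (triple_add t z\<^sub>2))}"

definition localization :: "('r::{ring,monoid_mult} \<Rightarrow> 'x::ab_group_add \<Rightarrow> 'x) \<Rightarrow> 'r mat set \<Rightarrow>
    ('r, 'x) triple set set" where
  "localization scale \<Sigma> = triples \<Sigma> // triple_equiv scale \<Sigma>"

definition triple_class :: "('r::{ring,monoid_mult} \<Rightarrow> 'x::ab_group_add \<Rightarrow> 'x) \<Rightarrow> 'r mat set \<Rightarrow>
    ('r, 'x) triple \<Rightarrow> ('r, 'x) triple set" where
  "triple_class scale \<Sigma> t = triple_equiv scale \<Sigma> `` {t}"

definition mu :: "('r::{ring,monoid_mult} \<Rightarrow> 'x::ab_group_add \<Rightarrow> 'x) \<Rightarrow> 'r mat set \<Rightarrow>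
    'x \<Rightarrow> ('r, 'x) triple set" where
  "mu scale \<Sigma> x = triple_class scale \<Sigma> (one_triple x)"

text \<open>The zero of the group \<open>\<Sigma>\<^sup>-\<^sup>1X\<close> is the class \<open>[1:1:0]\<close>.\<close>

definition ker_mu :: "('r::{ring,monoid_mult} \<Rightarrow> 'x::ab_group_add \<Rightarrow> 'x) \<Rightarrow> 'r mat set \<Rightarrow>
    'x set" where
  "ker_mu scale \<Sigma> = {x. mu scale \<Sigma> x = triple_class scale \<Sigma> (one_triple 0)}"

end

theory Submission
  imports Defs
begin

text \<open>
  Every triple of \<open>\<Sigma>\<^sup>-\<^sup>1X\<^sub>0\<close> lies, for \<open>\<ge>\<close>, below some \<open>(0, D, z)\<close> and above some \<open>(b, C, 0)\<close>, because
  \<open>(0, D, z) \<ge> (b, C, 0)\<close> always holds through zero matrices. Conversely \<open>s \<ge> t\<close> becomes a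
  congruence after null triples are added to both sides. Hence \<open>s \<sim> t\<close> holds if and only if
  \<open>s + (0, D, z) \<ge> t + (b, C, 0)\<close> for some such null triples, where the two sizes may differ. For
  \<open>s = (1, 1, 0)\<close> and \<open>t = (1, 1, x)\<close>, splitting the two matrices that witness \<open>\<ge>\<close> into blocks gives
  the relations in (3), with \<open>y = 0\<close>. A solution of (3) gives (2) back, through the matrix
  \<open>[[1, B], [0, D]]\<close>.
\<close>

section \<open>Identity, zero and negated matrices over an arbitrary ring\<close>

text \<open>The library's \<open>left_mult_one_mat\<close> and \<open>right_mult_one_mat\<close> exclude the zero ring.\<close>

lemma mult_one_mat_left:
  fixes A :: "'a::{semiring_0,monoid_mult} mat"
  assumes "A \<in> carrier_mat nr nc"
  shows "1\<^sub>m nr * A = A"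
proof (rule eq_matI)
  fix i j assume "i < dim_row A" "j < dim_col A"
  then show "(1\<^sub>m nr * A) $$ (i, j) = A $$ (i, j)"
    using assms by (simp add: scalar_prod_def if_distrib[of "\<lambda>c. c * _"] sum.delta cong: if_cong)
qed (use assms in auto)

lemma mult_one_mat_right:
  fixes A :: "'a::{semiring_0,monoid_mult} mat"
  assumes "A \<in> carrier_mat nr nc"
  shows "A * 1\<^sub>m nc = A"
proof (rule eq_matI)
  fix i j assume "i < dim_row A" "j < dim_col A"
  then show "(A * 1\<^sub>m nc) $$ (i, j) = A $$ (i, j)"
    using assms by (simp add: scalar_prod_def if_distrib[of "\<lambda>c. _ * c"] sum.delta' cong: if_cong)
qed (use assms in auto)

lemma mult_one_mat_left':
  fixes A :: "'a::{semiring_0,monoid_mult} mat"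
  shows "dim_row A = n \<Longrightarrow> 1\<^sub>m n * A = A"
  by (rule mult_one_mat_left) auto

lemma mult_one_mat_right':
  fixes A :: "'a::{semiring_0,monoid_mult} mat"
  shows "dim_col A = n \<Longrightarrow> A * 1\<^sub>m n = A"
  by (rule mult_one_mat_right) auto

lemma uminus_zero_mat: "- 0\<^sub>m nr nc = (0\<^sub>m nr nc :: 'a::group_add mat)"
  by (rule eq_matI) auto

lemma add_right_neg_mat:
  fixes A :: "'a::group_add mat"
  assumes "A \<in> carrier_mat nr nc"
  shows "A + - A = 0\<^sub>m nr nc"
  using assms by (intro eq_matI) auto

lemma add_eq_zero_matD:
  fixes A B :: "'a::group_add mat"
  assumes "A + B = 0\<^sub>m nr nc" "A \<in> carrier_mat nr nc" "B \<in> carrier_mat nr nc"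
  shows "A = - B"
proof (rule eq_matI)
  fix i j assume ij: "i < dim_row (- B)" "j < dim_col (- B)"
  with assms(2,3) have "A $$ (i, j) + B $$ (i, j) = (A + B) $$ (i, j)"
    by simp
  also have "\<dots> = 0"
    unfolding assms(1) using ij assms(2,3) by simp
  finally show "A $$ (i, j) = (- B) $$ (i, j)"
    using ij assms(2,3) by (simp add: eq_neg_iff_add_eq_0)
qed (use assms in auto)

section \<open>Concatenated rows and block matrices\<close>

lemma append_cols_carrier_mat [simp]:
  assumes "a \<in> carrier_mat nr n" "b \<in> carrier_mat nr m"
  shows "append_cols a b \<in> carrier_mat nr (n + m)"
  using assms unfolding append_cols_def carrier_mat_def by auto

lemma append_cols_index [simp]:
  assumes "a \<in> carrier_mat nr n" "b \<in> carrier_mat nr m" "i < nr" "j < n + m"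
  shows "append_cols a b $$ (i, j) = (if j < n then a $$ (i, j) else b $$ (i, j - n))"
  using assms unfolding append_cols_def by (subst index_mat_four_block) auto

lemma append_cols_assoc:
  assumes "a \<in> carrier_mat nr n" "b \<in> carrier_mat nr m" "c \<in> carrier_mat nr k"
  shows "append_cols (append_cols a b) c = append_cols a (append_cols b c)"
proof (rule eq_matI)
  have 1: "append_cols a b \<in> carrier_mat nr (n + m)" "append_cols b c \<in> carrier_mat nr (m + k)"
    using assms by auto
  then have 2: "append_cols a (append_cols b c) \<in> carrier_mat nr (n + (m + k))"
    "append_cols (append_cols a b) c \<in> carrier_mat nr ((n + m) + k)"
    using assms append_cols_carrier_mat by blast+
  then show "dim_row (append_cols (append_cols a b) c) = dim_row (append_cols a (append_cols b c))"
    "dim_col (append_cols (append_cols a b) c) = dim_col (append_cols a (append_cols b c))"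
    by auto
  fix i j
  assume "i < dim_row (append_cols a (append_cols b c))" "j < dim_col (append_cols a (append_cols b c))"
  then have ij: "i < nr" "j < n + m + k"
    using 2 by auto
  show "append_cols (append_cols a b) c $$ (i, j) = append_cols a (append_cols b c) $$ (i, j)"
    using ij assms append_cols_index[OF 1(1) assms(3), of i j]
      append_cols_index[OF assms(1) 1(2), of i j]
    by auto
qed

lemma append_vec_assoc: "(u @\<^sub>v v) @\<^sub>v w = u @\<^sub>v (v @\<^sub>v w)"
  by (rule eq_vecI) auto

lemma append_cols_eq_iff:
  assumes "a \<in> carrier_mat nr n" "a' \<in> carrier_mat nr n"
    "b \<in> carrier_mat nr m" "b' \<in> carrier_mat nr m"
  shows "append_cols a b = append_cols a' b' \<longleftrightarrow> a = a' \<and> b = b'"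
proof
  assume eq: "append_cols a b = append_cols a' b'"
  have "a $$ (i, j) = a' $$ (i, j)" if "i < nr" "j < n" for i j
    using arg_cong[OF eq, of "\<lambda>M. M $$ (i, j)"] that assms by simp
  moreover have "b $$ (i, j) = b' $$ (i, j)" if "i < nr" "j < m" for i j
    using arg_cong[OF eq, of "\<lambda>M. M $$ (i, n + j)"] that assms by simp
  ultimately show "a = a' \<and> b = b'"
    using assms by (auto intro!: eq_matI)
qed auto

text \<open>Each block is read off at indices shifted by \<open>nr1\<close> and \<open>nc1\<close>.
  This turns an equation between products of block matrices into one equation per block.\<close>

lemma four_block_mat_eqD:
  assumes "four_block_mat A B C D = four_block_mat A' B' C' D'"
    and "A \<in> carrier_mat nr1 nc1" "B \<in> carrier_mat nr1 nc2"
    and "C \<in> carrier_mat nr2 nc1" "D \<in> carrier_mat nr2 nc2"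
    and "A' \<in> carrier_mat nr1 nc1" "B' \<in> carrier_mat nr1 nc2"
    and "C' \<in> carrier_mat nr2 nc1" "D' \<in> carrier_mat nr2 nc2"
  shows "A = A'" "B = B'" "C = C'" "D = D'"
proof -
  have *: "four_block_mat A B C D $$ (i, j) = four_block_mat A' B' C' D' $$ (i, j)" for i j
    using assms(1) by simp
  show "A = A'"
  proof (rule eq_matI)
    fix i j assume "i < dim_row A'" "j < dim_col A'"
    with assms(2-) *[of i j] show "A $$ (i, j) = A' $$ (i, j)" by auto
  qed (use assms in auto)
  show "B = B'"
  proof (rule eq_matI)
    fix i j assume "i < dim_row B'" "j < dim_col B'"
    with assms(2-) *[of i "nc1 + j"] show "B $$ (i, j) = B' $$ (i, j)" by auto
  qed (use assms in auto)
  show "C = C'"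
  proof (rule eq_matI)
    fix i j assume "i < dim_row C'" "j < dim_col C'"
    with assms(2-) *[of "nr1 + i" j] show "C $$ (i, j) = C' $$ (i, j)" by auto
  qed (use assms in auto)
  show "D = D'"
  proof (rule eq_matI)
    fix i j assume "i < dim_row D'" "j < dim_col D'"
    with assms(2-) *[of "nr1 + i" "nc1 + j"] show "D $$ (i, j) = D' $$ (i, j)" by auto
  qed (use assms in auto)
qed

text \<open>\<open>append_cols\<close> is a block matrix whose lower blocks have no rows. The block
  product formula therefore applies, and the lower blocks of the product again have no rows.\<close>

lemma append_cols_mult_four_block:
  fixes a b :: "'a::semiring_0 mat"
  assumes "a \<in> carrier_mat nr n" "b \<in> carrier_mat nr m"
    and "A \<in> carrier_mat n n'" "B \<in> carrier_mat n m'"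
    and "C \<in> carrier_mat m n'" "D \<in> carrier_mat m m'"
  shows "append_cols a b * four_block_mat A B C D = append_cols (a * A + b * C) (a * B + b * D)"
proof -
  have "append_cols a b * four_block_mat A B C D =
      four_block_mat (a * A + b * C) (a * B + b * D)
        (0\<^sub>m 0 (dim_col a) * A + 0\<^sub>m 0 (dim_col b) * C) (0\<^sub>m 0 (dim_col a) * B + 0\<^sub>m 0 (dim_col b) * D)"
    unfolding append_cols_def by (rule mult_four_block_mat) (use assms in auto)
  also have "\<dots> = append_cols (a * A + b * C) (a * B + b * D)"
    unfolding append_cols_def using assms by (intro cong_four_block_mat) auto
  finally show ?thesis .
qed

lemma sum_lessThan_add:
  fixes f :: "nat \<Rightarrow> 'a::comm_monoid_add"
  shows "(\<Sum>j<n + m. f j) = (\<Sum>j<n. f j) + (\<Sum>j<m. f (n + j))"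
  by (induction m) (auto simp: add.assoc)

section \<open>The action of matrices on columns over the module\<close>

lemma dim_mat_act [simp]: "dim_vec (mat_act scale A v) = dim_row A"
  by (simp add: mat_act_def)

lemma mat_act_carrier [simp]: "A \<in> carrier_mat n m \<Longrightarrow> mat_act scale A v \<in> carrier_vec n"
  by (auto simp: mat_act_def)

lemma mat_act_four_block:
  assumes "A \<in> carrier_mat nr1 nc1" "B \<in> carrier_mat nr1 nc2"
    and "C \<in> carrier_mat nr2 nc1" "D \<in> carrier_mat nr2 nc2"
    and "u \<in> carrier_vec nc1" "v \<in> carrier_vec nc2"
  shows "mat_act scale (four_block_mat A B C D) (u @\<^sub>v v) =
    (mat_act scale A u + mat_act scale B v) @\<^sub>v (mat_act scale C u + mat_act scale D v)"
  by (rule eq_vecI) (use assms in \<open>auto simp: mat_act_def sum_lessThan_add\<close>)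

context left_module
begin

lemma scale_zero_left: "scale 0 x = 0"
  using scale_left_distrib[of 0 0 x] by simp

lemma scale_zero_right: "scale r 0 = 0"
  using scale_right_distrib[of r 0 0] by simp

lemma scale_sum_right: "scale r (sum f A) = (\<Sum>i\<in>A. scale r (f i))"
  by (induction A rule: infinite_finite_induct) (auto simp: scale_zero_right scale_right_distrib)

lemma scale_sum_left: "scale (sum f A) x = (\<Sum>i\<in>A. scale (f i) x)"
  by (induction A rule: infinite_finite_induct) (auto simp: scale_zero_left scale_left_distrib)

text \<open>Entrywise this is an interchange of two finite sums together with
  \<open>scale_scale\<close>. It lets witnesses compose in \<open>ge_trans\<close> and inverses
  cancel in \<open>cong_sym\<close>.\<close>

lemma mat_act_mult:
  assumes "A \<in> carrier_mat n m" "B \<in> carrier_mat m k"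
  shows "mat_act scale (A * B) v = mat_act scale A (mat_act scale B v)"
proof (rule eq_vecI)
  fix i assume "i < dim_vec (mat_act scale A (mat_act scale B v))"
  with assms have i: "i < n" by simp
  have "mat_act scale (A * B) v $ i =
      (\<Sum>j<k. \<Sum>l<m. scale (A $$ (i, l)) (scale (B $$ (l, j)) (v $ j)))"
    using assms i
    by (simp add: mat_act_def scalar_prod_def scale_sum_left scale_scale atLeast0LessThan)
  also have "\<dots> = (\<Sum>l<m. \<Sum>j<k. scale (A $$ (i, l)) (scale (B $$ (l, j)) (v $ j)))"
    by (rule sum.swap)
  also have "\<dots> = mat_act scale A (mat_act scale B v) $ i"
    using assms i by (simp add: mat_act_def scale_sum_right)
  finally show "mat_act scale (A * B) v $ i = mat_act scale A (mat_act scale B v) $ i" .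
qed (use assms in auto)

lemma mat_act_one:
  assumes "v \<in> carrier_vec n"
  shows "mat_act scale (1\<^sub>m n) v = v"
proof (rule eq_vecI)
  fix i assume "i < dim_vec v"
  then have i: "i < n" using assms by simp
  have "(\<Sum>j<n. scale (if i = j then 1 else 0) (v $ j)) = (\<Sum>j<n. if i = j then v $ j else 0)"
    by (rule sum.cong) (auto simp: scale_one scale_zero_left)
  with i show "mat_act scale (1\<^sub>m n) v $ i = v $ i"
    by (simp add: mat_act_def)
qed (use assms in auto)

lemma mat_act_zero_left: "dim_vec v = m \<Longrightarrow> mat_act scale (0\<^sub>m n m) v = 0\<^sub>v n"
  by (rule eq_vecI) (auto simp: mat_act_def scale_zero_left)

lemma mat_act_zero_right: "A \<in> carrier_mat n m \<Longrightarrow> mat_act scale A (0\<^sub>v m) = 0\<^sub>v n"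
  by (rule eq_vecI) (auto simp: mat_act_def scale_zero_right)

end

section \<open>Stacked matrices\<close>

lemma append_rows_eqD:
  assumes "A @\<^sub>r B = A' @\<^sub>r B'"
    and "A \<in> carrier_mat nr1 nc" "A' \<in> carrier_mat nr1 nc"
    and "B \<in> carrier_mat nr2 nc" "B' \<in> carrier_mat nr2 nc"
  shows "A = A'" "B = B'"
proof -
  \<comment> \<open>Stacking is a block matrix whose right-hand blocks have no columns, so
    uniqueness of blocks applies.\<close>
  have "four_block_mat A (0\<^sub>m nr1 0) B (0\<^sub>m nr2 0) = four_block_mat A' (0\<^sub>m nr1 0) B' (0\<^sub>m nr2 0)"
    using assms by (simp add: append_rows_def)
  note eqD = four_block_mat_eqD[OF this assms(2) zero_carrier_mat assms(4) zero_carrier_mat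
      assms(3) zero_carrier_mat assms(5) zero_carrier_mat]
  show "A = A'" "B = B'" by (rule eqD)+
qed

lemma four_block_carrier_matI:
  assumes "dim_row A + dim_row D = nr" "dim_col A + dim_col D = nc"
  shows "four_block_mat A B C D \<in> carrier_mat nr nc"
  using assms by (intro carrier_matI) simp_all

lemma four_block_mult_append_rows:
  fixes A :: "'a::semiring_0 mat"
  assumes "A \<in> carrier_mat nr1 n" "B \<in> carrier_mat nr1 m"
    and "C \<in> carrier_mat nr2 n" "D \<in> carrier_mat nr2 m"
    and "X \<in> carrier_mat n k" "Y \<in> carrier_mat m k"
  shows "four_block_mat A B C D * (X @\<^sub>r Y) = (A * X + B * Y) @\<^sub>r (C * X + D * Y)"
proof -
  have "four_block_mat A B C D * (X @\<^sub>r Y) =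
      four_block_mat (A * X + B * Y) (A * 0\<^sub>m n 0 + B * 0\<^sub>m m 0) (C * X + D * Y) (C * 0\<^sub>m n 0 + D * 0\<^sub>m m 0)"
    using assms unfolding append_rows_def by (subst mult_four_block_mat[of _ nr1 n _ m _ nr2 _ _ k _ 0]) auto
  also have "\<dots> = (A * X + B * Y) @\<^sub>r (C * X + D * Y)"
    unfolding append_rows_def using assms by (intro cong_four_block_mat) auto
  finally show ?thesis .
qed

section \<open>Triples and their sums\<close>

lemma triples_dim_iff:
  "(a, C, x) \<in> triples_dim \<Sigma> n \<longleftrightarrow>
    a \<in> carrier_mat 1 n \<and> C \<in> \<Sigma> \<and> C \<in> carrier_mat n n \<and> x \<in> carrier_vec n"
  by (simp add: triples_dim_def)

lemma triple_add_dims: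
  assumes "(a, C, x) \<in> triples_dim \<Sigma> n" "(b, D, y) \<in> triples_dim \<Sigma> m"
  shows "triple_add (a, C, x) (b, D, y) =
    (append_cols a b, four_block_mat C (0\<^sub>m n m) (0\<^sub>m m n) D, x @\<^sub>v y)"
  using assms by (auto simp: triples_dim_iff)

text \<open>Associativity holds as an equality of triples, so sums can be rebracketed freely inside
  \<open>\<ge>\<close> and congruence. Commutativity, in contrast, holds only up to an interchange
  of blocks; see \<open>ge_swap\<close>.\<close>

lemma triple_add_assoc:
  assumes "s \<in> triples_dim \<Sigma> n" "t \<in> triples_dim \<Sigma> m" "u \<in> triples_dim \<Sigma> k"
  shows "triple_add (triple_add s t) u = triple_add s (triple_add t u)"
proof -
  obtain a C x where s: "s = (a, C, x)" by (cases s)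
  obtain b D y where t: "t = (b, D, y)" by (cases t)
  obtain c E z where u: "u = (c, E, z)" by (cases u)
  show ?thesis
    using assms append_cols_assoc[of a 1 n b m c k] assoc_four_block_mat[of C D E]
    unfolding s t u by (simp add: triples_dim_iff append_vec_assoc)
qed

section \<open>Null triples with zero row or zero column\<close>

text \<open>The generators of the null triples are separated into two families because each family
  is closed under sums and every member of \<open>coeff_null\<close> lies above every member of
  \<open>vec_null\<close>. Mixed sums can then be enclosed between the two.\<close>

definition coeff_null :: "'r::zero mat set \<Rightarrow> ('r, 'x) triple set" where
  "coeff_null \<Sigma> = {(a, C, x). \<exists>n>0. (a, C, x) \<in> triples_dim \<Sigma> n \<and> a = 0\<^sub>m 1 n}"

definition vec_null :: "'r::zero mat set \<Rightarrow> ('r, 'x::zero) triple set" where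
  "vec_null \<Sigma> = {(a, C, x). \<exists>n>0. (a, C, x) \<in> triples_dim \<Sigma> n \<and> x = 0\<^sub>v n}"

lemma coeff_nullE:
  assumes "s \<in> coeff_null \<Sigma>"
  obtains n C x where "s = (0\<^sub>m 1 n, C, x)" "n > 0" "(0\<^sub>m 1 n, C, x) \<in> triples_dim \<Sigma> n"
  using assms by (cases s) (auto simp: coeff_null_def)

lemma vec_nullE:
  fixes s :: "('r::zero, 'x::zero) triple"
  assumes "s \<in> vec_null \<Sigma>"
  obtains n a C where "s = (a, C, 0\<^sub>v n)" "n > 0" "(a, C, 0\<^sub>v n :: 'x vec) \<in> triples_dim \<Sigma> n"
  using assms by (cases s) (auto simp: vec_null_def)

lemma null_generators_eq: "null_generators \<Sigma> = coeff_null \<Sigma> \<union> vec_null \<Sigma>"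
  by (auto simp: null_generators_def coeff_null_def vec_null_def)

lemma coeff_null_null: "s \<in> coeff_null \<Sigma> \<Longrightarrow> s \<in> null_triples \<Sigma>"
  by (auto intro: null_triples.generator simp: null_generators_eq)

lemma vec_null_null: "s \<in> vec_null \<Sigma> \<Longrightarrow> s \<in> null_triples \<Sigma>"
  by (auto intro: null_triples.generator simp: null_generators_eq)

section \<open>The relation \<open>\<ge>\<close> as a preorder compatible with sums\<close>

locale matrix_localization = left_module scale
  for scale :: "'r::{ring,monoid_mult} \<Rightarrow> 'x::ab_group_add \<Rightarrow> 'x" +
  fixes \<Sigma> :: "'r mat set"
  assumes mult: "multiplicative \<Sigma>"
begin

abbreviation ge (infix "\<succeq>" 50) where "s \<succeq> t \<equiv> triple_ge scale \<Sigma> s t"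
abbreviation add (infixl "\<uplus>" 65) where "s \<uplus> t \<equiv> triple_add s t"
abbreviation dims :: "nat \<Rightarrow> ('r, 'x) triple set" where "dims \<equiv> triples_dim \<Sigma>"
abbreviation all_triples :: "('r, 'x) triple set" ("\<T>") where "\<T> \<equiv> triples \<Sigma>"
abbreviation coeff_nulls :: "('r, 'x) triple set" ("\<L>") where "\<L> \<equiv> coeff_null \<Sigma>"
abbreviation vec_nulls :: "('r, 'x) triple set" ("\<Q>") where "\<Q> \<equiv> vec_null \<Sigma>"

lemma one_mat_in: "n > 0 \<Longrightarrow> 1\<^sub>m n \<in> \<Sigma>"
proof -
  assume n: "n > 0"
  have "permutation_mat n id = (1\<^sub>m n :: 'r mat)"
    by (rule eq_matI) (auto simp: permutation_mat_def)
  with mult n show ?thesis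
    unfolding multiplicative_def by (metis permutes_id)
qed

lemma block_in:
  assumes "C \<in> \<Sigma>" "D \<in> \<Sigma>" "C \<in> carrier_mat n n" "D \<in> carrier_mat m m" "A \<in> carrier_mat n m"
  shows "four_block_mat C A (0\<^sub>m m n) D \<in> \<Sigma>"
proof -
  have "four_block_mat C A (0\<^sub>m (dim_row D) (dim_col C)) D \<in> \<Sigma>"
    using mult assms unfolding multiplicative_def by (metis carrier_matD)
  with assms show ?thesis by simp
qed

lemma triples_iff: "s \<in> \<T> \<longleftrightarrow> (\<exists>n>0. s \<in> dims n)"
  by (auto simp: triples_def)

lemma triple_add_in:
  assumes "s \<in> dims n" "t \<in> dims m"
  shows "s \<uplus> t \<in> dims (n + m)"
proof (cases s; cases t)
  fix a C x b D y
  assume st: "s = (a, C, x)" "t = (b, D, y)"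
  show ?thesis
    using assms block_in[of C D n m "0\<^sub>m n m"] unfolding st
    by (simp add: triples_dim_iff) auto
qed

lemma triple_add_assoc':
  assumes "s \<in> \<T>" "t \<in> \<T>" "u \<in> \<T>"
  shows "s \<uplus> t \<uplus> u = s \<uplus> (t \<uplus> u)"
  using assms triple_add_assoc unfolding triples_iff by blast

lemma ge_intro:
  assumes "(a, C, x) \<in> dims n" "(b, D, y) \<in> dims m" "n > 0" "m > 0"
    and "A1 \<in> carrier_mat m n" "A2 \<in> carrier_mat m n"
    and "a = b * A1" "y = mat_act scale A2 x" "D * A1 = A2 * C"
  shows "(a, C, x) \<succeq> (b, D, y)"
  using assms unfolding triple_ge.simps by blast

lemma cong_intro:
  assumes "(a, C, x) \<in> dims n" "(b, D, y) \<in> dims n" "n > 0"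
    and "U1 \<in> carrier_mat n n" "U2 \<in> carrier_mat n n"
    and "\<exists>V\<in>carrier_mat n n. U1 * V = 1\<^sub>m n \<and> V * U1 = 1\<^sub>m n"
    and "\<exists>V\<in>carrier_mat n n. U2 * V = 1\<^sub>m n \<and> V * U2 = 1\<^sub>m n"
    and "a = b * U1" "y = mat_act scale U2 x" "D * U1 = U2 * C"
  shows "triple_cong scale \<Sigma> (a, C, x) (b, D, y)"
  using assms unfolding triple_cong.simps by blast

lemma ge_refl:
  assumes "s \<in> \<T>"
  shows "s \<succeq> s"
proof (cases s)
  case (fields a C x)
  with assms obtain n where n: "n > 0" "(a, C, x) \<in> dims n"
    by (auto simp: triples_iff)
  have "a = a * 1\<^sub>m n" "x = mat_act scale (1\<^sub>m n) x" "C * 1\<^sub>m n = 1\<^sub>m n * C"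
    using n mult_one_mat_left[of C n n] mult_one_mat_right[of C n n] mult_one_mat_right[of a 1 n]
    by (auto simp: triples_dim_iff mat_act_one)
  then show ?thesis
    unfolding fields by (rule ge_intro[OF n(2,2,1,1) one_carrier_mat one_carrier_mat])
qed

text \<open>The witnesses multiply: from \<open>D * A1 = A2 * C\<close> and
  \<open>E * B1 = B2 * D\<close> follows
  \<open>E * (B1 * A1) = B2 * D * A1 = B2 * A2 * C\<close>.\<close>

lemma ge_trans:
  assumes "s \<succeq> t" "t \<succeq> u"
  shows "s \<succeq> u"
proof (cases s; cases t; cases u)
  fix a C x b D y c E z
  assume st: "s = (a, C, x)" "t = (b, D, y)" "u = (c, E, z)"
  from assms(1) obtain n m A1 A2 where n: "n > 0" "m > 0"
    and d: "(a, C, x) \<in> dims n" "(b, D, y) \<in> dims m"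
    and A: "A1 \<in> carrier_mat m n" "A2 \<in> carrier_mat m n"
      "a = b * A1" "y = mat_act scale A2 x" "D * A1 = A2 * C"
    unfolding st triple_ge.simps by blast
  from assms(2) obtain m' k B1 B2 where k: "k > 0"
    and d': "(b, D, y) \<in> dims m'" "(c, E, z) \<in> dims k"
    and B: "B1 \<in> carrier_mat k m'" "B2 \<in> carrier_mat k m'"
      "b = c * B1" "z = mat_act scale B2 y" "E * B1 = B2 * D"
    unfolding st triple_ge.simps by blast
  \<comment> \<open>Each comparison brings its own size for the middle triple, and the components of
    that triple determine it.\<close>
  have "m' = m"
    using d(2) d'(1) by (auto simp: triples_dim_iff)
  note B = B[unfolded this]
  have car: "C \<in> carrier_mat n n" "D \<in> carrier_mat m m" "E \<in> carrier_mat k k" "c \<in> carrier_mat 1 k"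
    using d d' by (auto simp: triples_dim_iff)
  have "a = c * (B1 * A1)"
    using A(3) B(3) assoc_mult_mat[OF car(4) B(1) A(1)] by simp
  moreover have "z = mat_act scale (B2 * A2) x"
    using A B by (simp add: mat_act_mult[OF B(2) A(2)])
  moreover have "E * (B1 * A1) = B2 * A2 * C"
    using A(5) B(5) assoc_mult_mat[OF car(3) B(1) A(1)] assoc_mult_mat[OF B(2) car(2) A(1)]
      assoc_mult_mat[OF B(2) A(2) car(1)] by simp
  ultimately show ?thesis
    unfolding st
    by (rule ge_intro[OF d(1) d'(2) n(1) k mult_carrier_mat[OF B(1) A(1)] mult_carrier_mat[OF B(2) A(2)]])
qed

text \<open>The witnesses of the two comparisons are placed on a block diagonal. They are
  rectangular, so the off-diagonal zero blocks have the mixed sizes \<open>m\<close>,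
  \<open>n'\<close> and \<open>m'\<close>, \<open>n\<close>.\<close>

lemma ge_add:
  assumes "s \<succeq> t" "s' \<succeq> t'"
  shows "s \<uplus> s' \<succeq> t \<uplus> t'"
proof (cases s; cases t; cases s'; cases t')
  fix a C x b D y a' C' x' b' D' y'
  assume st: "s = (a, C, x)" "t = (b, D, y)" "s' = (a', C', x')" "t' = (b', D', y')"
  from assms(1) obtain n m A1 A2 where n: "n > 0" "m > 0"
    and d: "(a, C, x) \<in> dims n" "(b, D, y) \<in> dims m"
    and A: "A1 \<in> carrier_mat m n" "A2 \<in> carrier_mat m n"
    and A': "a = b * A1" "y = mat_act scale A2 x" "D * A1 = A2 * C"
    unfolding st triple_ge.simps by blast
  from assms(2) obtain n' m' B1 B2 where n': "n' > 0" "m' > 0"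
    and d': "(a', C', x') \<in> dims n'" "(b', D', y') \<in> dims m'"
    and B: "B1 \<in> carrier_mat m' n'" "B2 \<in> carrier_mat m' n'"
    and B': "a' = b' * B1" "y' = mat_act scale B2 x'" "D' * B1 = B2 * C'"
    unfolding st triple_ge.simps by blast
  have car: "b \<in> carrier_mat 1 m" "b' \<in> carrier_mat 1 m'"
    "x \<in> carrier_vec n" "x' \<in> carrier_vec n'" "C \<in> carrier_mat n n" "D \<in> carrier_mat m m"
    "C' \<in> carrier_mat n' n'" "D' \<in> carrier_mat m' m'"
    using d d' by (auto simp: triples_dim_iff)
  let ?F = "\<lambda>X Y. four_block_mat X (0\<^sub>m m n') (0\<^sub>m m' n) Y"
  have "append_cols b b' * ?F A1 B1 =
      append_cols (b * A1 + b' * 0\<^sub>m m' n) (b * 0\<^sub>m m n' + b' * B1)"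
    using A B car by (intro append_cols_mult_four_block) auto
  also have "b * A1 + b' * 0\<^sub>m m' n = a"
    using A B car A' right_add_zero_mat[of "b * A1" 1 n] by simp
  also have "b * 0\<^sub>m m n' + b' * B1 = a'"
    using A B car B' left_add_zero_mat[of "b' * B1" 1 n'] by simp
  finally have 1: "append_cols a a' = append_cols b b' * ?F A1 B1" by simp
  have "mat_act scale (?F A2 B2) (x @\<^sub>v x') =
     (mat_act scale A2 x + mat_act scale (0\<^sub>m m n') x') @\<^sub>v (mat_act scale (0\<^sub>m m' n) x + mat_act scale B2 x')"
    using A B car by (intro mat_act_four_block) auto
  then have 2: "y @\<^sub>v y' = mat_act scale (?F A2 B2) (x @\<^sub>v x')"
    using A B A' B' car by (simp add: mat_act_zero_left)
  have "four_block_mat D (0\<^sub>m m m') (0\<^sub>m m' m) D' * ?F A1 B1 = ?F (D * A1) (D' * B1)"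
    using A B car right_add_zero_mat[of "D * A1" m n] left_add_zero_mat[of "D' * B1" m' n']
    by (subst mult_four_block_mat[of _ m m _ m' _ m' _ _ n _ n']) auto
  also have "\<dots> = ?F A2 B2 * four_block_mat C (0\<^sub>m n n') (0\<^sub>m n' n) C'"
    using A B A' B' car right_add_zero_mat[of "A2 * C" m n] left_add_zero_mat[of "B2 * C'" m' n']
    by (subst mult_four_block_mat[of _ m n _ n' _ m' _ _ n _ n']) auto
  finally have 3: "four_block_mat D (0\<^sub>m m m') (0\<^sub>m m' m) D' * ?F A1 B1 =
    ?F A2 B2 * four_block_mat C (0\<^sub>m n n') (0\<^sub>m n' n) C'" .
  have 4: "?F A1 B1 \<in> carrier_mat (m + m') (n + n')" "?F A2 B2 \<in> carrier_mat (m + m') (n + n')"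
    using A B by auto
  have 5: "(append_cols a a', four_block_mat C (0\<^sub>m n n') (0\<^sub>m n' n) C', x @\<^sub>v x') \<in> dims (n + n')"
    "(append_cols b b', four_block_mat D (0\<^sub>m m m') (0\<^sub>m m' m) D', y @\<^sub>v y') \<in> dims (m + m')"
    using triple_add_in[OF d(1) d'(1)] triple_add_in[OF d(2) d'(2)]
    unfolding triple_add_dims[OF d(1) d'(1)] triple_add_dims[OF d(2) d'(2)] by auto
  show ?thesis
    unfolding st triple_add_dims[OF d(1) d'(1)] triple_add_dims[OF d(2) d'(2)]
    by (rule ge_intro[OF 5 _ _ 4 1 2 3]) (use n in simp_all)
qed

text \<open>The block permutation matrix \<open>?P\<close> interchanges the two groups of
  coordinates and serves as both witnesses. This is the form of commutativity that the transitivity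
  of the equivalence uses.\<close>

lemma ge_swap:
  assumes "s \<in> \<T>" "t \<in> \<T>"
  shows "s \<uplus> t \<succeq> t \<uplus> s"
proof (cases s; cases t)
  fix a C x b D y
  assume st: "s = (a, C, x)" "t = (b, D, y)"
  obtain n m where n: "n > 0" "m > 0" and d: "(a, C, x) \<in> dims n" "(b, D, y) \<in> dims m"
    using assms unfolding st triples_iff by blast
  have car: "a \<in> carrier_mat 1 n" "b \<in> carrier_mat 1 m" "x \<in> carrier_vec n" "y \<in> carrier_vec m"
    "C \<in> carrier_mat n n" "D \<in> carrier_mat m m"
    using d by (auto simp: triples_dim_iff)
  let ?P = "four_block_mat (0\<^sub>m m n) (1\<^sub>m m) (1\<^sub>m n) (0\<^sub>m n m) :: 'r mat"
  have "append_cols b a * ?P = append_cols (b * 0\<^sub>m m n + a * 1\<^sub>m n) (b * 1\<^sub>m m + a * 0\<^sub>m n m)"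
    using car by (intro append_cols_mult_four_block) auto
  then have 1: "append_cols a b = append_cols b a * ?P"
    using car left_add_zero_mat[of a 1 n] right_add_zero_mat[of b 1 m]
    by (simp add: mult_one_mat_right)
  have "mat_act scale ?P (x @\<^sub>v y) =
     (mat_act scale (0\<^sub>m m n) x + mat_act scale (1\<^sub>m m) y) @\<^sub>v (mat_act scale (1\<^sub>m n) x + mat_act scale (0\<^sub>m n m) y)"
    using car by (intro mat_act_four_block) auto
  then have 2: "y @\<^sub>v x = mat_act scale ?P (x @\<^sub>v y)"
    using car by (simp add: mat_act_zero_left mat_act_one)
  have "four_block_mat D (0\<^sub>m m n) (0\<^sub>m n m) C * ?P = four_block_mat (0\<^sub>m m n) D C (0\<^sub>m n m)"
    using car by (subst mult_four_block_mat[of _ m m _ n _ n _ _ n _ m]) (auto simp: mult_one_mat_right')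
  also have "\<dots> = ?P * four_block_mat C (0\<^sub>m n m) (0\<^sub>m m n) D"
    using car by (subst mult_four_block_mat[of _ m n _ m _ n _ _ n _ m]) (auto simp: mult_one_mat_left')
  finally have 3: "four_block_mat D (0\<^sub>m m n) (0\<^sub>m n m) C * ?P = ?P * four_block_mat C (0\<^sub>m n m) (0\<^sub>m m n) D" .
  have 4: "?P \<in> carrier_mat (m + n) (n + m)"
    by (simp add: four_block_carrier_matI)
  have 5: "(append_cols a b, four_block_mat C (0\<^sub>m n m) (0\<^sub>m m n) D, x @\<^sub>v y) \<in> dims (n + m)"
    "(append_cols b a, four_block_mat D (0\<^sub>m m n) (0\<^sub>m n m) C, y @\<^sub>v x) \<in> dims (m + n)"
    using triple_add_in[OF d] triple_add_in[OF d(2,1)]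
    unfolding triple_add_dims[OF d] triple_add_dims[OF d(2,1)] by auto
  show ?thesis
    unfolding st triple_add_dims[OF d] triple_add_dims[OF d(2,1)]
    by (rule ge_intro[OF 5 _ _ 4 4 1 2 3]) (use n in simp_all)
qed

section \<open>Bounds for null triples\<close>

lemma coeff_null_add: "s \<in> \<L> \<Longrightarrow> t \<in> \<L> \<Longrightarrow> s \<uplus> t \<in> \<L>"
proof (elim coeff_nullE)
  fix n m C x D y
  assume st: "s = (0\<^sub>m 1 n, C, x)" "t = (0\<^sub>m 1 m, D, y)"
    and d: "n > 0" "m > 0" "(0\<^sub>m 1 n, C, x) \<in> dims n" "(0\<^sub>m 1 m, D, y) \<in> dims m"
  have "append_cols (0\<^sub>m 1 n) (0\<^sub>m 1 m) = (0\<^sub>m 1 (n + m) :: 'r mat)"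
    by (simp add: append_cols_def)
  with triple_add_in[OF d(3,4)] d show ?thesis
    unfolding st triple_add_dims[OF d(3,4)] coeff_null_def by auto
qed

lemma vec_null_add: "s \<in> \<Q> \<Longrightarrow> t \<in> \<Q> \<Longrightarrow> s \<uplus> t \<in> \<Q>"
proof (elim vec_nullE)
  fix n m C a D b
  assume st: "s = (a, C, 0\<^sub>v n)" "t = (b, D, 0\<^sub>v m)"
    and d: "n > 0" "m > 0" "(a, C, 0\<^sub>v n) \<in> dims n" "(b, D, 0\<^sub>v m) \<in> dims m"
  have "0\<^sub>v n @\<^sub>v 0\<^sub>v m = (0\<^sub>v (n + m) :: 'x vec)"
    by (rule eq_vecI) auto
  with triple_add_in[OF d(3,4)] d show ?thesis
    unfolding st triple_add_dims[OF d(3,4)] vec_null_def by auto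
qed

lemma coeff_null_triples: "s \<in> \<L> \<Longrightarrow> s \<in> \<T>"
  by (auto simp: coeff_null_def triples_iff)

lemma vec_null_triples: "s \<in> \<Q> \<Longrightarrow> s \<in> \<T>"
  by (auto simp: vec_null_def triples_iff)

text \<open>A triple with zero row and zero column lies in both families. It supplies the default
  bound wherever only one of the two bounds is prescribed.\<close>

lemma zero_triple_null:
  "(0\<^sub>m 1 1, 1\<^sub>m 1, 0\<^sub>v 1) \<in> \<L>" "(0\<^sub>m 1 1, 1\<^sub>m 1, 0\<^sub>v 1) \<in> \<Q>"
  using one_mat_in[of 1] by (auto simp: coeff_null_def vec_null_def triples_dim_iff intro!: exI[of _ 1])

lemma coeff_null_ge_vec_null:
  assumes "s \<in> \<L>" "t \<in> \<Q>"
  shows "s \<succeq> t"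
  using assms
proof (elim coeff_nullE vec_nullE)
  fix n m C x b D
  assume st: "s = (0\<^sub>m 1 n, C, x)" "t = (b, D, 0\<^sub>v m)"
    and d: "n > 0" "m > 0" "(0\<^sub>m 1 n, C, x) \<in> dims n" "(b, D, 0\<^sub>v m) \<in> dims m"
  have "0\<^sub>m 1 n = b * 0\<^sub>m m n" "0\<^sub>v m = mat_act scale (0\<^sub>m m n) x" "D * 0\<^sub>m m n = 0\<^sub>m m n * C"
    using d by (auto simp: triples_dim_iff mat_act_zero_left)
  then show ?thesis
    unfolding st by (rule ge_intro[OF d(3,4,1,2) zero_carrier_mat zero_carrier_mat])
qed

text \<open>A generator is its own bound on one side, and the zero triple bounds it on the other.
  For sums the bounds are added, since both families are closed under sums and \<open>\<ge>\<close>
  is compatible with them.\<close>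

lemma null_triples_between:
  assumes "w \<in> null_triples \<Sigma>"
  shows "\<exists>p\<in>\<L>. \<exists>q\<in>\<Q>. p \<succeq> w \<and> w \<succeq> q"
  using assms
proof induction
  case (generator w)
  then consider "w \<in> \<L>" | "w \<in> \<Q>"
    unfolding null_generators_eq by blast
  then show ?case
  proof cases
    case 1
    with ge_refl[OF coeff_null_triples[OF 1]] coeff_null_ge_vec_null[OF 1 zero_triple_null(2)]
    show ?thesis using zero_triple_null(2) by blast
  next
    case 2
    with ge_refl[OF vec_null_triples[OF 2]] coeff_null_ge_vec_null[OF zero_triple_null(1) 2]
    show ?thesis using zero_triple_null(1) by blast
  qed
next
  case (add s t)
  then obtain p q p' q' where "p \<in> \<L>" "q \<in> \<Q>" "p \<succeq> s" "s \<succeq> q"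
    "p' \<in> \<L>" "q' \<in> \<Q>" "p' \<succeq> t" "t \<succeq> q'" by blast
  then show ?case
    using coeff_null_add[of p p'] vec_null_add[of q q'] ge_add[of p s p' t] ge_add[of s q t q'] by blast
qed

section \<open>Passing between congruence and comparison\<close>

lemma cong_imp_ge: "triple_cong scale \<Sigma> s t \<Longrightarrow> s \<succeq> t"
  by (cases s; cases t) auto

text \<open>The inverses \<open>V1\<close> and \<open>V2\<close> witness the reversed congruence:
  multiplying \<open>D * U1 = U2 * C\<close> by \<open>V2\<close> on the left and by
  \<open>V1\<close> on the right gives \<open>V2 * D = C * V1\<close>.\<close>

lemma cong_sym:
  assumes "triple_cong scale \<Sigma> s t"
  shows "triple_cong scale \<Sigma> t s"
proof (cases s; cases t)
  fix a C x b D y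
  assume st: "s = (a, C, x)" "t = (b, D, y)"
  from assms obtain n U1 U2 V1 V2 where n: "n > 0" and d: "(a, C, x) \<in> dims n" "(b, D, y) \<in> dims n"
    and U: "U1 \<in> carrier_mat n n" "U2 \<in> carrier_mat n n"
    and V: "V1 \<in> carrier_mat n n" "V2 \<in> carrier_mat n n"
    and inv: "U1 * V1 = 1\<^sub>m n" "V1 * U1 = 1\<^sub>m n" "U2 * V2 = 1\<^sub>m n" "V2 * U2 = 1\<^sub>m n"
    and eq: "a = b * U1" "y = mat_act scale U2 x" "D * U1 = U2 * C"
    unfolding st triple_cong.simps by blast
  have car: "b \<in> carrier_mat 1 n" "x \<in> carrier_vec n" "C \<in> carrier_mat n n" "D \<in> carrier_mat n n"
    using d by (auto simp: triples_dim_iff)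
  have 1: "b = a * V1"
    using eq(1) assoc_mult_mat[OF car(1) U(1) V(1)] mult_one_mat_right[OF car(1)] inv by simp
  have 2: "x = mat_act scale V2 y"
    using eq(2) mat_act_mult[OF V(2) U(2), of x] inv car(2) by (simp add: mat_act_one)
  have "C = V2 * U2 * C"
    unfolding inv by (rule mult_one_mat_left[OF car(3), symmetric])
  also have "\<dots> = V2 * D * U1"
    using eq(3) assoc_mult_mat[OF V(2) U(2) car(3)] assoc_mult_mat[OF V(2) car(4) U(1)] by simp
  finally have "C * V1 = V2 * D * (U1 * V1)"
    using assoc_mult_mat[OF mult_carrier_mat[OF V(2) car(4)] U(1) V(1)] by simp
  then have 3: "C * V1 = V2 * D"
    using inv mult_one_mat_right[OF mult_carrier_mat[OF V(2) car(4)]] by simp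
  show ?thesis
    unfolding st by (rule cong_intro[OF d(2,1) n V _ _ 1 2 3]) (use U inv in blast)+
qed

text \<open>The matrices \<open>[[A\<^sub>1, 1], [1, 0]]\<close> and \<open>[[A\<^sub>2, 1], [1, 0]]\<close> are invertible for all \<open>A\<^sub>1\<close> and
  \<open>A\<^sub>2\<close>, so a comparison becomes a congruence once each side receives a null copy of the other.\<close>

lemma ge_imp_cong:
  assumes "s \<succeq> t"
  shows "\<exists>q\<in>\<Q>. \<exists>p\<in>\<L>. triple_cong scale \<Sigma> (s \<uplus> q) (t \<uplus> p)"
proof (cases s; cases t)
  fix a C x b D y
  assume st: "s = (a, C, x)" "t = (b, D, y)"
  from assms obtain n m A1 A2 where n: "n > 0" "m > 0"
    and d: "(a, C, x) \<in> dims n" "(b, D, y) \<in> dims m"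
    and A: "A1 \<in> carrier_mat m n" "A2 \<in> carrier_mat m n"
    and eq: "a = b * A1" "y = mat_act scale A2 x" "D * A1 = A2 * C"
    unfolding st triple_ge.simps by blast
  have car: "a \<in> carrier_mat 1 n" "b \<in> carrier_mat 1 m" "x \<in> carrier_vec n" "y \<in> carrier_vec m"
    "C \<in> carrier_mat n n" "D \<in> carrier_mat m m" "C \<in> \<Sigma>" "D \<in> \<Sigma>"
    using d by (auto simp: triples_dim_iff)
  \<comment> \<open>The copy of \<open>t\<close> keeps its row and loses its column, while the copy
    of \<open>s\<close> keeps its column and loses its row. With these choices the row
    \<open>[b 0]\<close> is carried to \<open>[b * A1, b]\<close>, which is \<open>[a b]\<close>,
    and the column \<open>(x, 0)\<close> to \<open>(A2 x, x)\<close>, which is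
    \<open>(y, x)\<close>.\<close>
  have d': "(b, D, 0\<^sub>v m) \<in> dims m" "(0\<^sub>m 1 n, C, x) \<in> dims n"
    using car by (auto simp: triples_dim_iff)
  then have null: "(b, D, 0\<^sub>v m) \<in> \<Q>" "(0\<^sub>m 1 n, C, x) \<in> \<L>"
    using n by (auto simp: vec_null_def coeff_null_def)
  let ?U = "\<lambda>A. four_block_mat A (1\<^sub>m m) (1\<^sub>m n) (0\<^sub>m n m) :: 'r mat"
  \<comment> \<open>This is the explicit two-sided inverse of \<open>?U A\<close>. The rows of
    \<open>?U A\<close> are split as \<open>m\<close>, \<open>n\<close> and its columns as
    \<open>n\<close>, \<open>m\<close>, so it is square although \<open>A\<close> may be
    rectangular.\<close>
  let ?V = "\<lambda>A. four_block_mat (0\<^sub>m n m) (1\<^sub>m n) (1\<^sub>m m) (- A) :: 'r mat"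
  have U: "?U A \<in> carrier_mat (n + m) (n + m)" if "A \<in> carrier_mat m n" for A
    using that by (simp add: four_block_carrier_matI)
  have inv: "\<exists>V\<in>carrier_mat (n + m) (n + m). ?U A * V = 1\<^sub>m (n + m) \<and> V * ?U A = 1\<^sub>m (n + m)"
    if "A \<in> carrier_mat m n" for A
  proof (intro bexI conjI)
    show "?V A \<in> carrier_mat (n + m) (n + m)"
      using that by (simp add: four_block_carrier_matI)
    have "?U A * ?V A = four_block_mat (1\<^sub>m m) (0\<^sub>m m n) (0\<^sub>m n m) (1\<^sub>m n)"
      using that by (subst mult_four_block_mat[of _ m n _ m _ n _ _ m _ n])
        (auto simp: mult_one_mat_left' mult_one_mat_right' add_right_neg_mat uminus_zero_mat)
    then show "?U A * ?V A = 1\<^sub>m (n + m)"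
      by (simp add: add.commute)
    have "- A + A = 0\<^sub>m m n"
      using that by (intro eq_matI) auto
    then have "?V A * ?U A = four_block_mat (1\<^sub>m n) (0\<^sub>m n m) (0\<^sub>m m n) (1\<^sub>m m)"
      using that add_right_neg_mat[OF that] by (subst mult_four_block_mat[of _ n m _ n _ m _ _ n _ m])
        (auto simp: mult_one_mat_left' mult_one_mat_right')
    then show "?V A * ?U A = 1\<^sub>m (n + m)"
      by simp
  qed
  have "append_cols b (0\<^sub>m 1 n) * ?U A1 =
      append_cols (b * A1 + 0\<^sub>m 1 n * 1\<^sub>m n) (b * 1\<^sub>m m + 0\<^sub>m 1 n * 0\<^sub>m n m)"
    using car A by (intro append_cols_mult_four_block) auto
  also have "b * A1 + 0\<^sub>m 1 n * 1\<^sub>m n = a"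
    using car A eq right_add_zero_mat[of a 1 n] by simp
  also have "b * 1\<^sub>m m + 0\<^sub>m 1 n * 0\<^sub>m n m = b"
    using car right_add_zero_mat[of b 1 m] by (simp add: mult_one_mat_right)
  finally have 1: "append_cols a b = append_cols b (0\<^sub>m 1 n) * ?U A1" by simp
  have "mat_act scale (?U A2) (x @\<^sub>v 0\<^sub>v m) =
     (mat_act scale A2 x + mat_act scale (1\<^sub>m m) (0\<^sub>v m)) @\<^sub>v
     (mat_act scale (1\<^sub>m n) x + mat_act scale (0\<^sub>m n m) (0\<^sub>v m))"
    using car A by (intro mat_act_four_block) auto
  then have 2: "y @\<^sub>v x = mat_act scale (?U A2) (x @\<^sub>v 0\<^sub>v m)"
    using car eq by (simp add: mat_act_zero_left mat_act_one)
  have "four_block_mat D (0\<^sub>m m n) (0\<^sub>m n m) C * ?U A1 = four_block_mat (D * A1) D C (0\<^sub>m n m)"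
    using car A right_add_zero_mat[of "D * A1" m n] by (subst mult_four_block_mat[of _ m m _ n _ n _ _ n _ m]) (auto simp: mult_one_mat_right')
  also have "\<dots> = ?U A2 * four_block_mat C (0\<^sub>m n m) (0\<^sub>m m n) D"
    using car A eq right_add_zero_mat[of "A2 * C" m n]
    by (subst mult_four_block_mat[of _ m n _ m _ n _ _ n _ m]) (auto simp: mult_one_mat_left')
  finally have 3: "four_block_mat D (0\<^sub>m m n) (0\<^sub>m n m) C * ?U A1 =
    ?U A2 * four_block_mat C (0\<^sub>m n m) (0\<^sub>m m n) D" .
  have 5: "(append_cols a b, four_block_mat C (0\<^sub>m n m) (0\<^sub>m m n) D, x @\<^sub>v 0\<^sub>v m) \<in> dims (n + m)"
    "(append_cols b (0\<^sub>m 1 n), four_block_mat D (0\<^sub>m m n) (0\<^sub>m n m) C, y @\<^sub>v x) \<in> dims (n + m)"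
    using triple_add_in[OF d(1) d'(1)] triple_add_in[OF d(2) d'(2)]
    unfolding triple_add_dims[OF d(1) d'(1)] triple_add_dims[OF d(2) d'(2)] by (auto simp: add.commute)
  have "triple_cong scale \<Sigma> (s \<uplus> (b, D, 0\<^sub>v m)) (t \<uplus> (0\<^sub>m 1 n, C, x))"
    unfolding st triple_add_dims[OF d(1) d'(1)] triple_add_dims[OF d(2) d'(2)]
    by (rule cong_intro[OF 5 _ U[OF A(1)] U[OF A(2)] inv[OF A(1)] inv[OF A(2)] 1 2 3]) (use n in simp)
  with null show ?thesis by blast
qed

section \<open>Equivalence of triples and the kernel\<close>

text \<open>From left to right, the null triples are replaced by their bounds: \<open>s \<uplus> p
  \<succeq> s \<uplus> z1 \<succeq> t \<uplus> z2 \<succeq> t \<uplus> q\<close>, where the middle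
  comparison is the given congruence. From right to left, \<open>ge_imp_cong\<close> adds further
  null triples, which associativity collects with \<open>p\<close> and \<open>q\<close>.\<close>

lemma triple_equiv_iff:
  "(s, t) \<in> triple_equiv scale \<Sigma> \<longleftrightarrow> s \<in> \<T> \<and> t \<in> \<T> \<and>
    (\<exists>p\<in>\<L>. \<exists>q\<in>\<Q>. s \<uplus> p \<succeq> t \<uplus> q)"
proof (intro iffI conjI)
  assume "(s, t) \<in> triple_equiv scale \<Sigma>"
  then obtain z1 z2 where st: "s \<in> \<T>" "t \<in> \<T>"
    and z: "z1 \<in> null_triples \<Sigma>" "z2 \<in> null_triples \<Sigma>"
    and c: "triple_cong scale \<Sigma> (s \<uplus> z1) (t \<uplus> z2)"
    by (auto simp: triple_equiv_def)
  show "s \<in> \<T>" "t \<in> \<T>" by fact+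
  obtain p where p: "p \<in> \<L>" "p \<succeq> z1"
    using null_triples_between[OF z(1)] by blast
  obtain q where q: "q \<in> \<Q>" "z2 \<succeq> q"
    using null_triples_between[OF z(2)] by blast
  have "s \<uplus> p \<succeq> t \<uplus> q"
    using ge_add[OF ge_refl[OF st(1)] p(2)] cong_imp_ge[OF c] ge_add[OF ge_refl[OF st(2)] q(2)]
    by (blast intro: ge_trans)
  with p q show "\<exists>p\<in>\<L>. \<exists>q\<in>\<Q>. s \<uplus> p \<succeq> t \<uplus> q" by blast
next
  assume *: "s \<in> \<T> \<and> t \<in> \<T> \<and> (\<exists>p\<in>\<L>. \<exists>q\<in>\<Q>. s \<uplus> p \<succeq> t \<uplus> q)"
  then obtain p q where pq: "p \<in> \<L>" "q \<in> \<Q>" "s \<uplus> p \<succeq> t \<uplus> q" by blast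
  from ge_imp_cong[OF pq(3)] obtain q' p' where pq': "q' \<in> \<Q>" "p' \<in> \<L>"
    and c: "triple_cong scale \<Sigma> (s \<uplus> p \<uplus> q') (t \<uplus> q \<uplus> p')" by blast
  have "triple_cong scale \<Sigma> (s \<uplus> (p \<uplus> q')) (t \<uplus> (q \<uplus> p'))"
    using c * pq pq' by (simp add: triple_add_assoc' coeff_null_triples vec_null_triples)
  then show "(s, t) \<in> triple_equiv scale \<Sigma>"
    using * pq pq' unfolding triple_equiv_def
    by (blast intro: null_triples.add coeff_null_null vec_null_null)
qed

text \<open>The two descriptions share the work: symmetry is read off the definition by congruence,
  since \<open>\<succeq>\<close> is one-sided, while reflexivity and transitivity are read off the
  description by \<open>\<succeq>\<close>.\<close>

lemma equiv_triple_equiv: "equiv \<T> (triple_equiv scale \<Sigma>)"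
proof (rule equivI)
  show "triple_equiv scale \<Sigma> \<subseteq> \<T> \<times> \<T>"
    by (auto simp: triple_equiv_def)
  show "refl_on \<T> (triple_equiv scale \<Sigma>)"
    unfolding refl_on_def triple_equiv_iff
    using ge_add ge_refl coeff_null_ge_vec_null zero_triple_null by blast
  show "sym (triple_equiv scale \<Sigma>)"
    unfolding sym_def triple_equiv_def using cong_sym by blast
  show "trans (triple_equiv scale \<Sigma>)"
  proof (rule transI)
    fix s t u
    assume "(s, t) \<in> triple_equiv scale \<Sigma>" "(t, u) \<in> triple_equiv scale \<Sigma>"
    then obtain p q p' q' where T: "s \<in> \<T>" "t \<in> \<T>" "u \<in> \<T>"
      and pq: "p \<in> \<L>" "q \<in> \<Q>" "s \<uplus> p \<succeq> t \<uplus> q"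
      and pq': "p' \<in> \<L>" "q' \<in> \<Q>" "t \<uplus> p' \<succeq> u \<uplus> q'"
      unfolding triple_equiv_iff by blast
    note null = coeff_null_triples[OF pq(1)] vec_null_triples[OF pq(2)]
      coeff_null_triples[OF pq'(1)] vec_null_triples[OF pq'(2)]
    have "s \<uplus> p \<uplus> p' \<succeq> t \<uplus> q \<uplus> p'"
      by (rule ge_add[OF pq(3) ge_refl[OF null(3)]])
    \<comment> \<open>The first comparison ends with \<open>q\<close> next to \<open>t\<close>, but
      the second one starts with \<open>p'\<close> next to \<open>t\<close>; the two null summands
      must change places in between.\<close>
    moreover have "t \<uplus> (q \<uplus> p') \<succeq> t \<uplus> (p' \<uplus> q)"
      by (rule ge_add[OF ge_refl[OF T(2)] ge_swap[OF null(2,3)]])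
    moreover have "t \<uplus> p' \<uplus> q \<succeq> u \<uplus> q' \<uplus> q"
      by (rule ge_add[OF pq'(3) ge_refl[OF null(2)]])
    ultimately have "s \<uplus> (p \<uplus> p') \<succeq> u \<uplus> (q' \<uplus> q)"
      using T null by (auto simp: triple_add_assoc' intro: ge_trans)
    then show "(s, u) \<in> triple_equiv scale \<Sigma>"
      using T pq pq' coeff_null_add vec_null_add unfolding triple_equiv_iff by blast
  qed
qed

lemma one_triple_in: "one_triple v \<in> dims 1"
  using one_mat_in[of 1] by (auto simp: one_triple_def triples_dim_iff)

text \<open>Equality of classes may be read in either direction. It is turned round so that
  \<open>one_triple 0\<close> stands on the larger side, as in (2).\<close>

lemma ker_mu_iff:
  "v \<in> ker_mu scale \<Sigma> \<longleftrightarrow>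
    (\<exists>p\<in>\<L>. \<exists>q\<in>\<Q>. one_triple 0 \<uplus> p \<succeq> one_triple v \<uplus> q)"
proof -
  have T: "one_triple w \<in> \<T>" for w
    using one_triple_in[of w] unfolding triples_iff by (intro exI[of _ 1]) simp
  have "v \<in> ker_mu scale \<Sigma> \<longleftrightarrow> triple_equiv scale \<Sigma> `` {one_triple 0} = triple_equiv scale \<Sigma> `` {one_triple v}"
    unfolding ker_mu_def mu_def triple_class_def mem_Collect_eq by (rule eq_commute)
  also have "\<dots> \<longleftrightarrow> (one_triple 0, one_triple v) \<in> triple_equiv scale \<Sigma>"
    using eq_equiv_class_iff[OF equiv_triple_equiv T T] by blast
  finally show ?thesis
    using T by (simp add: triple_equiv_iff)
qed

section \<open>Comparisons with zero and matrix relations\<close>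

text \<open>Let the witnesses be \<open>A1 = [[p, q], [r, s]]\<close> and
  \<open>A2 = [[p', q'], [r', s']]\<close>. The comparison yields \<open>q + a * s = 0\<close>,
  \<open>q = q' * D\<close> and \<open>C * s = s' * D\<close>, and it says that \<open>q'\<close>
  sends \<open>z\<close> to \<open>v\<close> and \<open>s'\<close> sends \<open>z\<close> to 0.
  Hence the choice of \<open>- a\<close>, \<open>q'\<close>, \<open>s'\<close> and
  \<open>- s\<close> for \<open>a11\<close>, \<open>a12\<close>, \<open>A\<close> and
  \<open>B\<close>; the signs make both sums in the matrix relation cancel.\<close>

lemma relation_if_ge:
  assumes a: "a \<in> carrier_mat 1 n" and z: "z \<in> carrier_vec m"
    and C: "C \<in> carrier_mat n n" and D: "D \<in> carrier_mat m m" and Sigma: "C \<in> \<Sigma>" "D \<in> \<Sigma>"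
    and ge: "one_triple 0 \<uplus> (0\<^sub>m 1 m, D, z) \<succeq> one_triple v \<uplus> (a, C, 0\<^sub>v n)"
  shows "\<exists>a11\<in>carrier_mat 1 n. \<exists>a12\<in>carrier_mat 1 m. \<exists>A\<in>carrier_mat n m. \<exists>B\<in>carrier_mat n m.
      vec 1 (\<lambda>_. v) @\<^sub>v 0\<^sub>v n = mat_act scale (four_block_mat a11 a12 C A) (0\<^sub>v n @\<^sub>v z) \<and>
      four_block_mat a11 a12 C A * (B @\<^sub>r D) = 0\<^sub>m 1 m @\<^sub>r 0\<^sub>m n m"
proof -
  have one: "(1\<^sub>m 1, 1\<^sub>m 1, vec 1 (\<lambda>_. w)) \<in> dims 1" for w
    using one_triple_in[of w] by (simp add: one_triple_def)
  have d: "(0\<^sub>m 1 m, D, z) \<in> dims m" "(a, C, 0\<^sub>v n) \<in> dims n"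
    using assms by (auto simp: triples_dim_iff)
  obtain k l A1 A2
    where dd: "(append_cols (1\<^sub>m 1) (0\<^sub>m 1 m), four_block_mat (1\<^sub>m 1) (0\<^sub>m 1 m) (0\<^sub>m m 1) D, vec 1 (\<lambda>_. 0) @\<^sub>v z) \<in> dims k"
      "(append_cols (1\<^sub>m 1) a, four_block_mat (1\<^sub>m 1) (0\<^sub>m 1 n) (0\<^sub>m n 1) C, vec 1 (\<lambda>_. v) @\<^sub>v 0\<^sub>v n) \<in> dims l"
      and A0: "A1 \<in> carrier_mat l k" "A2 \<in> carrier_mat l k"
      and eq: "append_cols (1\<^sub>m 1) (0\<^sub>m 1 m) = append_cols (1\<^sub>m 1) a * A1"
      "vec 1 (\<lambda>_. v) @\<^sub>v 0\<^sub>v n = mat_act scale A2 (vec 1 (\<lambda>_. 0) @\<^sub>v z)"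
      "four_block_mat (1\<^sub>m 1) (0\<^sub>m 1 n) (0\<^sub>m n 1) C * A1 = A2 * four_block_mat (1\<^sub>m 1) (0\<^sub>m 1 m) (0\<^sub>m m 1) D"
    using ge unfolding one_triple_def triple_add_dims[OF one d(1)] triple_add_dims[OF one d(2)]
      triple_ge.simps by blast
  \<comment> \<open>The sizes are read off the middle entries of the two sums.\<close>
  have "k = 1 + m" "l = 1 + n"
    using dd[unfolded triples_dim_iff, THEN conjunct2, THEN conjunct2, THEN conjunct1, THEN carrier_matD(1)]
      C D by simp_all
  with A0 have A: "dim_row A1 = 1 + n" "dim_col A1 = 1 + m" "dim_row A2 = 1 + n" "dim_col A2 = 1 + m"
    by auto
  \<comment> \<open>The cut after the first row and column separates the summand
    \<open>one_triple\<close> from the null summand.\<close>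
  obtain p q r s where "split_block A1 1 1 = (p, q, r, s)" by (metis prod_cases4)
  note A1 = split_block[OF this A(1,2)]
  obtain p' q' r' s' where "split_block A2 1 1 = (p', q', r', s')" by (metis prod_cases4)
  note A2 = split_block[OF this A(3,4)]
  have "append_cols (1\<^sub>m 1) a * A1 = append_cols (1\<^sub>m 1 * p + a * r) (1\<^sub>m 1 * q + a * s)"
    unfolding A1(5) using A1(1-4) a by (intro append_cols_mult_four_block) auto
  then have "append_cols (1\<^sub>m 1) (0\<^sub>m 1 m) = append_cols (p + a * r) (q + a * s)"
    unfolding eq(1)[symmetric] mult_one_mat_left[OF A1(1)] mult_one_mat_left[OF A1(2)] .
  then have "0\<^sub>m 1 m = q + a * s"
    using A1(1-4) a append_cols_eq_iff[of "1\<^sub>m 1" 1 1 "p + a * r" "0\<^sub>m 1 m" m "q + a * s"] by simp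
  then have q: "q = - (a * s)"
    by (rule add_eq_zero_matD[OF sym A1(2) mult_carrier_mat[OF a A1(4)]])
  have "four_block_mat (1\<^sub>m 1) (0\<^sub>m 1 n) (0\<^sub>m n 1) C * A1 =
      four_block_mat (1\<^sub>m 1 * p + 0\<^sub>m 1 n * r) (1\<^sub>m 1 * q + 0\<^sub>m 1 n * s) (0\<^sub>m n 1 * p + C * r) (0\<^sub>m n 1 * q + C * s)"
    unfolding A1(5) using A1(1-4) C by (intro mult_four_block_mat) auto
  also have "\<dots> = four_block_mat p q (C * r) (C * s)"
    using A1(1-4) C by (intro cong_four_block_mat) (simp_all add: mult_one_mat_left')
  finally have 1: "four_block_mat (1\<^sub>m 1) (0\<^sub>m 1 n) (0\<^sub>m n 1) C * A1 = four_block_mat p q (C * r) (C * s)" .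
  have "A2 * four_block_mat (1\<^sub>m 1) (0\<^sub>m 1 m) (0\<^sub>m m 1) D =
      four_block_mat (p' * 1\<^sub>m 1 + q' * 0\<^sub>m m 1) (p' * 0\<^sub>m 1 m + q' * D) (r' * 1\<^sub>m 1 + s' * 0\<^sub>m m 1) (r' * 0\<^sub>m 1 m + s' * D)"
    unfolding A2(5) using A2(1-4) D by (intro mult_four_block_mat) auto
  also have "\<dots> = four_block_mat p' (q' * D) r' (s' * D)"
    using A2(1-4) D left_add_zero_mat[of "s' * D" n m] left_add_zero_mat[of "q' * D" 1 m]
    by (intro cong_four_block_mat) (simp_all add: mult_one_mat_right')
  finally have "four_block_mat p q (C * r) (C * s) = four_block_mat p' (q' * D) r' (s' * D)"
    using 1 eq(3) by simp
  \<comment> \<open>The right-hand blocks give \<open>q = q' * D\<close> and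
    \<open>C * s = s' * D\<close>; the first is combined with \<open>q = - (a * s)\<close>.\<close>
  from four_block_mat_eqD[OF this A1(1,2) mult_carrier_mat[OF C A1(3)] mult_carrier_mat[OF C A1(4)]
      A2(1) mult_carrier_mat[OF A2(2) D] A2(3) mult_carrier_mat[OF A2(4) D]]
  have qD: "q' * D = - (a * s)" and sD: "s' * D = C * s"
    using q by auto
  \<comment> \<open>The column of \<open>one_triple 0\<close> is a zero vector, so \<open>p'\<close>
    and \<open>r'\<close> contribute nothing below.\<close>
  have zero: "vec 1 (\<lambda>_. 0) = (0\<^sub>v 1 :: 'x vec)"
    by (rule eq_vecI) auto
  have "mat_act scale A2 (vec 1 (\<lambda>_. 0) @\<^sub>v z) =
      (mat_act scale p' (0\<^sub>v 1) + mat_act scale q' z) @\<^sub>v (mat_act scale r' (0\<^sub>v 1) + mat_act scale s' z)"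
    unfolding A2(5) zero using A2(1-4) z by (intro mat_act_four_block) auto
  with eq(2) have v: "vec 1 (\<lambda>_. v) @\<^sub>v 0\<^sub>v n = mat_act scale q' z @\<^sub>v mat_act scale s' z"
    using A2(1-4) left_zero_vec[of "mat_act scale q' z" 1] left_zero_vec[of "mat_act scale s' z" n]
    by (simp add: mat_act_zero_right)
  \<comment> \<open>The zero vector in place of \<open>y\<close> annihilates the blocks
    \<open>- a\<close> and \<open>C\<close>, which leaves exactly the action of \<open>q'\<close>
    and \<open>s'\<close> on \<open>z\<close>.\<close>
  have "mat_act scale (four_block_mat (- a) q' C s') (0\<^sub>v n @\<^sub>v z) =
      (mat_act scale (- a) (0\<^sub>v n) + mat_act scale q' z) @\<^sub>v (mat_act scale C (0\<^sub>v n) + mat_act scale s' z)"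
    using A2(1-4) a C z by (intro mat_act_four_block) auto
  also have "\<dots> = vec 1 (\<lambda>_. v) @\<^sub>v 0\<^sub>v n"
    unfolding mat_act_zero_right[OF uminus_carrier_mat[OF a]] mat_act_zero_right[OF C] v
      left_zero_vec[OF mat_act_carrier[OF A2(2)]] left_zero_vec[OF mat_act_carrier[OF A2(4)]] ..
  finally have 1: "vec 1 (\<lambda>_. v) @\<^sub>v 0\<^sub>v n = mat_act scale (four_block_mat (- a) q' C s') (0\<^sub>v n @\<^sub>v z)"
    by simp
  have neg: "- a * - s = a * s" "C * - s = - (C * s)"
    using a C A1(4) by (auto simp: uminus_mult_left_mat uminus_mult_right_mat)
  have "four_block_mat (- a) q' C s' * (- s @\<^sub>r D) = (- a * - s + q' * D) @\<^sub>r (C * - s + s' * D)"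
    using a C D A1(4) A2(2,4) by (intro four_block_mult_append_rows) auto
  also have "- a * - s + q' * D = 0\<^sub>m 1 m"
    unfolding neg qD using a A1(4) by (intro add_right_neg_mat) auto
  also have "C * - s + s' * D = 0\<^sub>m n m"
    unfolding neg sD using C A1(4) by (intro eq_matI) auto
  finally have 2: "four_block_mat (- a) q' C s' * (- s @\<^sub>r D) = 0\<^sub>m 1 m @\<^sub>r 0\<^sub>m n m" .
  show ?thesis
    using 1 2 a A1(4) A2(2,4)
    by (intro bexI[of _ "- a"] bexI[of _ q'] bexI[of _ s'] bexI[of _ "- s"] conjI) auto
qed

text \<open>The witnesses are \<open>[[1, q], [0, s]]\<close> and \<open>[[1, q'], [0, s']]\<close>.
  For these the comparison amounts to \<open>q + a * s = 0\<close>, \<open>q' * F = q\<close>,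
  \<open>s' * F = E * s\<close>, and to \<open>q'\<close> sending \<open>w\<close> to
  \<open>v\<close> and \<open>s'\<close> sending \<open>w\<close> to 0. The matrix relation gives
  the equations with \<open>F\<close>, the module relation those with \<open>w\<close>.\<close>

lemma ge_if_relation:
  assumes n: "n > 0" "m > 0" and a: "a11 \<in> carrier_mat 1 n" "a12 \<in> carrier_mat 1 m"
    and C: "C \<in> carrier_mat n n" and D: "D \<in> carrier_mat m m" and Sigma: "C \<in> \<Sigma>" "D \<in> \<Sigma>"
    and AB: "A \<in> carrier_mat n m" "B \<in> carrier_mat n m"
    and yz: "y \<in> carrier_vec n" "z \<in> carrier_vec m"
    and v: "vec 1 (\<lambda>_. v) @\<^sub>v 0\<^sub>v n = mat_act scale (four_block_mat a11 a12 C A) (y @\<^sub>v z)"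
    and rel: "four_block_mat a11 a12 C A * (B @\<^sub>r D) = 0\<^sub>m 1 m @\<^sub>r 0\<^sub>m n m"
  shows "\<exists>a\<in>carrier_mat 1 (n + m). \<exists>w\<in>carrier_vec (n + m).
    \<exists>E\<in>\<Sigma> \<inter> carrier_mat (n + m) (n + m). \<exists>F\<in>\<Sigma> \<inter> carrier_mat (n + m) (n + m).
      one_triple 0 \<uplus> (0\<^sub>m 1 (n + m), F, w) \<succeq> one_triple v \<uplus> (a, E, 0\<^sub>v (n + m))"
proof -
  \<comment> \<open>\<open>w\<close> collects \<open>y\<close> and \<open>z\<close>, and \<open>F\<close> absorbs \<open>B\<close>; the identity block in \<open>E\<close> only equalises the
    sizes of \<open>E\<close> and \<open>F\<close>.\<close>
  define N where "N = n + m"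
  define E where "E = four_block_mat C (0\<^sub>m n m) (0\<^sub>m m n) (1\<^sub>m m)"
  define F where "F = four_block_mat (1\<^sub>m n) B (0\<^sub>m m n) D"
  define w where "w = y @\<^sub>v z"
  \<comment> \<open>\<open>s\<close> projects onto the first \<open>n\<close> coordinates and
    therefore fixes \<open>a\<close>; the opposite signs in \<open>a\<close> and \<open>q\<close>
    then give \<open>q + a * s = 0\<close>.\<close>
  define a where "a = append_cols (- a11) (0\<^sub>m 1 m)"
  define q where "q = append_cols a11 (0\<^sub>m 1 m)"
  define q' where "q' = append_cols a11 a12"
  define s where "s = four_block_mat (1\<^sub>m n) (0\<^sub>m n m) (0\<^sub>m m n) (0\<^sub>m m m :: 'r mat)"
  define s' where "s' = four_block_mat C A (0\<^sub>m m n) (0\<^sub>m m m)"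
  have car: "E \<in> carrier_mat N N" "F \<in> carrier_mat N N" "w \<in> carrier_vec N" "a \<in> carrier_mat 1 N"
    "q \<in> carrier_mat 1 N" "q' \<in> carrier_mat 1 N" "s \<in> carrier_mat N N" "s' \<in> carrier_mat N N"
    using assms unfolding N_def E_def F_def w_def a_def q_def q'_def s_def s'_def by auto
  have in_Sigma: "E \<in> \<Sigma>" "F \<in> \<Sigma>"
    unfolding E_def F_def using Sigma C D AB one_mat_in n by (auto intro!: block_in)
  have "mat_act scale (four_block_mat a11 a12 C A) (y @\<^sub>v z) =
      (mat_act scale a11 y + mat_act scale a12 z) @\<^sub>v (mat_act scale C y + mat_act scale A z)"
    using a C AB yz by (intro mat_act_four_block) auto
  then have v': "vec 1 (\<lambda>_. v) = mat_act scale a11 y + mat_act scale a12 z"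
    "0\<^sub>v n = mat_act scale C y + mat_act scale A z"
    using v a append_vec_eq[of "vec 1 (\<lambda>_. v)" 1 "mat_act scale a11 y + mat_act scale a12 z" "0\<^sub>v n"
        "mat_act scale C y + mat_act scale A z"] by auto
  have "four_block_mat a11 a12 C A * (B @\<^sub>r D) = (a11 * B + a12 * D) @\<^sub>r (C * B + A * D)"
    using a C AB D by (intro four_block_mult_append_rows) auto
  then have "0\<^sub>m 1 m @\<^sub>r 0\<^sub>m n m = (a11 * B + a12 * D) @\<^sub>r (C * B + A * D)"
    using rel by simp
  then have rel': "0\<^sub>m 1 m = a11 * B + a12 * D" "0\<^sub>m n m = C * B + A * D"
    using a C AB D by (auto elim!: append_rows_eqD[of _ _ _ _ 1 m n])
  have q'w: "mat_act scale q' w = vec 1 (\<lambda>_. v)"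
  proof -
    have "mat_act scale q' w =
        (mat_act scale a11 y + mat_act scale a12 z) @\<^sub>v
        (mat_act scale (0\<^sub>m 0 (dim_col a11)) y + mat_act scale (0\<^sub>m 0 (dim_col a12)) z)"
      unfolding q'_def append_cols_def w_def using a yz by (intro mat_act_four_block) auto
    also have "\<dots> = vec 1 (\<lambda>_. v)"
      unfolding v'(1)[symmetric] by (rule eq_vecI) auto
    finally show ?thesis .
  qed
  have s'w: "mat_act scale s' w = 0\<^sub>v N"
  proof -
    have "mat_act scale s' w = (mat_act scale C y + mat_act scale A z) @\<^sub>v
        (mat_act scale (0\<^sub>m m n) y + mat_act scale (0\<^sub>m m m) z)"
      unfolding s'_def w_def using C AB yz by (intro mat_act_four_block) auto
    also have "\<dots> = 0\<^sub>v n @\<^sub>v 0\<^sub>v m"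
      unfolding v'(2)[symmetric] using yz by (simp add: mat_act_zero_left)
    also have "\<dots> = 0\<^sub>v N"
      unfolding N_def by (rule eq_vecI) auto
    finally show ?thesis .
  qed
  have q'F: "q' * F = q"
  proof -
    have "q' * F = append_cols (a11 * 1\<^sub>m n + a12 * 0\<^sub>m m n) (a11 * B + a12 * D)"
      unfolding q'_def F_def using a AB D by (intro append_cols_mult_four_block) auto
    then show ?thesis
      unfolding q_def using a rel'(1) right_add_zero_mat[of a11 1 n] by (simp add: mult_one_mat_right')
  qed
  \<comment> \<open>The product is \<open>[[C, C * B + A * D], [0, 0]]\<close>. The matrix relation
    removes the upper right block, and what remains is also \<open>E * s\<close>.\<close>
  have "s' * F = four_block_mat (C * 1\<^sub>m n + A * 0\<^sub>m m n) (C * B + A * D)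
      (0\<^sub>m m n * 1\<^sub>m n + 0\<^sub>m m m * 0\<^sub>m m n) (0\<^sub>m m n * B + 0\<^sub>m m m * D)"
    unfolding s'_def F_def using C AB D by (intro mult_four_block_mat) auto
  also have "\<dots> = four_block_mat C (0\<^sub>m n m) (0\<^sub>m m n) (0\<^sub>m m m)"
    using C AB D rel'(2) by (intro cong_four_block_mat) (simp_all add: mult_one_mat_right')
  also have "\<dots> = four_block_mat (C * 1\<^sub>m n + 0\<^sub>m n m * 0\<^sub>m m n) (C * 0\<^sub>m n m + 0\<^sub>m n m * 0\<^sub>m m m)
      (0\<^sub>m m n * 1\<^sub>m n + 1\<^sub>m m * 0\<^sub>m m n) (0\<^sub>m m n * 0\<^sub>m n m + 1\<^sub>m m * 0\<^sub>m m m)"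
    using C by (intro cong_four_block_mat) (simp_all add: mult_one_mat_right')
  also have "\<dots> = E * s"
    unfolding E_def s_def using C by (intro mult_four_block_mat[symmetric]) auto
  finally have s'F: "s' * F = E * s" .
  have "a * s = append_cols (- a11 * 1\<^sub>m n + 0\<^sub>m 1 m * 0\<^sub>m m n) (- a11 * 0\<^sub>m n m + 0\<^sub>m 1 m * 0\<^sub>m m m)"
    unfolding a_def s_def using a by (intro append_cols_mult_four_block) auto
  then have "a * s = a"
    unfolding a_def using a right_add_zero_mat[of "- a11" 1 n]
    by (simp add: mult_one_mat_right' del: uminus_mult_left_mat)
  moreover have "q + a = 0\<^sub>m 1 N"
  proof (rule eq_matI)
    fix i j assume "i < dim_row (0\<^sub>m 1 N)" "j < dim_col (0\<^sub>m 1 N)"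
    then show "(q + a) $$ (i, j) = 0\<^sub>m 1 N $$ (i, j)"
      using a car append_cols_index[OF a(1) zero_carrier_mat, of i j m]
        append_cols_index[of "- a11" 1 n "0\<^sub>m 1 m" m i j]
      unfolding q_def[symmetric] a_def[symmetric] N_def by auto
  qed (use car in auto)
  ultimately have qas: "q + a * s = 0\<^sub>m 1 N" by simp
  let ?A1 = "four_block_mat (1\<^sub>m 1) q (0\<^sub>m N 1) s"
  let ?A2 = "four_block_mat (1\<^sub>m 1) q' (0\<^sub>m N 1) s'"
  have zero: "vec 1 (\<lambda>_. 0) = (0\<^sub>v 1 :: 'x vec)"
    by (rule eq_vecI) auto
  have "append_cols (1\<^sub>m 1) a * ?A1 = append_cols (1\<^sub>m 1 * 1\<^sub>m 1 + a * 0\<^sub>m N 1) (1\<^sub>m 1 * q + a * s)"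
    using car by (intro append_cols_mult_four_block) auto
  then have 1: "append_cols (1\<^sub>m 1) (0\<^sub>m 1 N) = append_cols (1\<^sub>m 1) a * ?A1"
    using car qas by (simp add: mult_one_mat_left')
  have "mat_act scale ?A2 (vec 1 (\<lambda>_. 0) @\<^sub>v w) =
     (mat_act scale (1\<^sub>m 1) (0\<^sub>v 1) + mat_act scale q' w) @\<^sub>v (mat_act scale (0\<^sub>m N 1) (0\<^sub>v 1) + mat_act scale s' w)"
    unfolding zero using car by (intro mat_act_four_block) auto
  then have 2: "vec 1 (\<lambda>_. v) @\<^sub>v 0\<^sub>v N = mat_act scale ?A2 (vec 1 (\<lambda>_. 0) @\<^sub>v w)"
    unfolding q'w s'w by (simp add: mat_act_one mat_act_zero_left)
  \<comment> \<open>Both products have the blocks \<open>1\<close>, \<open>q\<close>,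
    \<open>0\<close> and \<open>E * s\<close>, by \<open>q' * F = q\<close> and
    \<open>s' * F = E * s\<close>.\<close>
  have "four_block_mat (1\<^sub>m 1) (0\<^sub>m 1 N) (0\<^sub>m N 1) E * ?A1 =
      four_block_mat (1\<^sub>m 1 * 1\<^sub>m 1 + 0\<^sub>m 1 N * 0\<^sub>m N 1) (1\<^sub>m 1 * q + 0\<^sub>m 1 N * s)
        (0\<^sub>m N 1 * 1\<^sub>m 1 + E * 0\<^sub>m N 1) (0\<^sub>m N 1 * q + E * s)"
    using car by (intro mult_four_block_mat) auto
  also have "\<dots> = four_block_mat (1\<^sub>m 1 * 1\<^sub>m 1 + q' * 0\<^sub>m N 1) (1\<^sub>m 1 * 0\<^sub>m 1 N + q' * F)
      (0\<^sub>m N 1 * 1\<^sub>m 1 + s' * 0\<^sub>m N 1) (0\<^sub>m N 1 * 0\<^sub>m 1 N + s' * F)"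
    unfolding q'F s'F using car by (intro cong_four_block_mat) (simp_all add: mult_one_mat_left')
  also have "\<dots> = ?A2 * four_block_mat (1\<^sub>m 1) (0\<^sub>m 1 N) (0\<^sub>m N 1) F"
    using car by (intro mult_four_block_mat[symmetric]) auto
  finally have 3: "four_block_mat (1\<^sub>m 1) (0\<^sub>m 1 N) (0\<^sub>m N 1) E * ?A1 =
    ?A2 * four_block_mat (1\<^sub>m 1) (0\<^sub>m 1 N) (0\<^sub>m N 1) F" .
  have one: "(1\<^sub>m 1, 1\<^sub>m 1, vec 1 (\<lambda>_. u)) \<in> dims 1" for u
    using one_triple_in[of u] by (simp add: one_triple_def)
  have d: "(0\<^sub>m 1 N, F, w) \<in> dims N" "(a, E, 0\<^sub>v N) \<in> dims N"
    using car in_Sigma by (auto simp: triples_dim_iff)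
  have dd: "(append_cols (1\<^sub>m 1) (0\<^sub>m 1 N), four_block_mat (1\<^sub>m 1) (0\<^sub>m 1 N) (0\<^sub>m N 1) F, vec 1 (\<lambda>_. 0) @\<^sub>v w) \<in> dims (1 + N)"
    "(append_cols (1\<^sub>m 1) a, four_block_mat (1\<^sub>m 1) (0\<^sub>m 1 N) (0\<^sub>m N 1) E, vec 1 (\<lambda>_. v) @\<^sub>v 0\<^sub>v N) \<in> dims (1 + N)"
    using triple_add_in[OF one d(1)] triple_add_in[OF one d(2)]
    unfolding triple_add_dims[OF one d(1)] triple_add_dims[OF one d(2)] by blast+
  have A12: "?A1 \<in> carrier_mat (1 + N) (1 + N)" "?A2 \<in> carrier_mat (1 + N) (1 + N)"
    using car by auto
  have "one_triple 0 \<uplus> (0\<^sub>m 1 N, F, w) \<succeq> one_triple v \<uplus> (a, E, 0\<^sub>v N)"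
    unfolding one_triple_def triple_add_dims[OF one d(1)] triple_add_dims[OF one d(2)]
    by (rule ge_intro[OF dd _ _ A12 1 2 3]) simp_all
  with car in_Sigma show ?thesis
    unfolding N_def by blast
qed

text \<open>The two null triples are unrelated, so their sizes may differ. Condition (2) is the case
  of a common size, which membership in the kernel reaches by way of (3).\<close>

lemma ker_mu_iff_ge:
  "v \<in> ker_mu scale \<Sigma> \<longleftrightarrow>
    (\<exists>n>0. \<exists>m>0. \<exists>a\<in>carrier_mat 1 n. \<exists>z\<in>carrier_vec m.
      \<exists>C\<in>\<Sigma> \<inter> carrier_mat n n. \<exists>D\<in>\<Sigma> \<inter> carrier_mat m m.
        one_triple 0 \<uplus> (0\<^sub>m 1 m, D, z) \<succeq> one_triple v \<uplus> (a, C, 0\<^sub>v n))"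
  (is "_ \<longleftrightarrow> ?R")
proof
  assume "v \<in> ker_mu scale \<Sigma>"
  then obtain p q where "p \<in> \<L>" "q \<in> \<Q>" and ge: "one_triple 0 \<uplus> p \<succeq> one_triple v \<uplus> q"
    unfolding ker_mu_iff by blast
  then obtain m D z n a C where p: "p = (0\<^sub>m 1 m, D, z)" "m > 0" "(0\<^sub>m 1 m, D, z) \<in> dims m"
    and q: "q = (a, C, 0\<^sub>v n)" "n > 0" "(a, C, 0\<^sub>v n) \<in> dims n"
    by (elim coeff_nullE vec_nullE)
  have "a \<in> carrier_mat 1 n" "z \<in> carrier_vec m" "C \<in> \<Sigma> \<inter> carrier_mat n n" "D \<in> \<Sigma> \<inter> carrier_mat m m"
    using p(3) q(3) by (auto simp: triples_dim_iff)
  with p(2) q(2) ge[unfolded p(1) q(1)] show ?R by blast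
next
  assume ?R
  then obtain n m a z C D where nm: "n > 0" "m > 0" and car: "a \<in> carrier_mat 1 n" "z \<in> carrier_vec m"
    "C \<in> \<Sigma> \<inter> carrier_mat n n" "D \<in> \<Sigma> \<inter> carrier_mat m m"
    and ge: "one_triple 0 \<uplus> (0\<^sub>m 1 m, D, z) \<succeq> one_triple v \<uplus> (a, C, 0\<^sub>v n)" by blast
  have "(0\<^sub>m 1 m, D, z) \<in> \<L>" "(a, C, 0\<^sub>v n) \<in> \<Q>"
    using nm car by (auto simp: coeff_null_def vec_null_def triples_dim_iff)
  with ge show "v \<in> ker_mu scale \<Sigma>"
    unfolding ker_mu_iff by blast
qed

end

section \<open>The cycle of implications from (1) to (3) to (2) to (1)\<close>

theorem theorem12:
  fixes scale :: "'r::{ring,monoid_mult} \<Rightarrow> 'x::ab_group_add \<Rightarrow> 'x"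
    and \<Sigma> :: "'r mat set"
    and x :: 'x
  assumes "left_module scale"
    and "multiplicative \<Sigma>"
  shows
    "(x \<in> ker_mu scale \<Sigma> \<longleftrightarrow>
       (\<exists>n>0. \<exists>a\<in>carrier_mat 1 n. \<exists>z\<in>carrier_vec n.
        \<exists>C\<in>\<Sigma> \<inter> carrier_mat n n. \<exists>D\<in>\<Sigma> \<inter> carrier_mat n n.
          triple_ge scale \<Sigma>
            (triple_add (one_triple 0) (0\<^sub>m 1 n, D, z))
            (triple_add (one_triple x) (a, C, 0\<^sub>v n)))) \<and>
     (x \<in> ker_mu scale \<Sigma> \<longleftrightarrow>
       (\<exists>n>0. \<exists>m>0.
        \<exists>a\<^sub>1\<^sub>1\<in>carrier_mat 1 n. \<exists>a\<^sub>1\<^sub>2\<in>carrier_mat 1 m.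
        \<exists>C\<in>\<Sigma> \<inter> carrier_mat n n. \<exists>D\<in>\<Sigma> \<inter> carrier_mat m m.
        \<exists>A\<in>carrier_mat n m. \<exists>B\<in>carrier_mat n m.
        \<exists>y\<in>carrier_vec n. \<exists>z\<in>carrier_vec m.
          vec 1 (\<lambda>_. x) @\<^sub>v 0\<^sub>v n =
            mat_act scale (four_block_mat a\<^sub>1\<^sub>1 a\<^sub>1\<^sub>2 C A) (y @\<^sub>v z) \<and>
          four_block_mat a\<^sub>1\<^sub>1 a\<^sub>1\<^sub>2 C A * (B @\<^sub>r D) = 0\<^sub>m 1 m @\<^sub>r 0\<^sub>m n m))"
    (is "(_ \<longleftrightarrow> ?two) \<and> (_ \<longleftrightarrow> ?three)")
proof -
  interpret matrix_localization scale \<Sigma>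
    using assms by (simp add: matrix_localization_def matrix_localization_axioms_def)
  have 13: "?three" if "x \<in> ker_mu scale \<Sigma>"
  proof -
    from that obtain n m a z C D where nm: "n > 0" "m > 0"
      and car: "a \<in> carrier_mat 1 n" "z \<in> carrier_vec m"
        "C \<in> \<Sigma>" "C \<in> carrier_mat n n" "D \<in> \<Sigma>" "D \<in> carrier_mat m m"
      and ge: "triple_ge scale \<Sigma> (triple_add (one_triple 0) (0\<^sub>m 1 m, D, z))
        (triple_add (one_triple x) (a, C, 0\<^sub>v n))"
      unfolding ker_mu_iff_ge by blast
    from relation_if_ge[OF car(1,2,4,6,3,5) ge] obtain a11 a12 A B
      where *: "a11 \<in> carrier_mat 1 n" "a12 \<in> carrier_mat 1 m" "A \<in> carrier_mat n m" "B \<in> carrier_mat n m"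
        "vec 1 (\<lambda>_. x) @\<^sub>v 0\<^sub>v n = mat_act scale (four_block_mat a11 a12 C A) (0\<^sub>v n @\<^sub>v z)"
        "four_block_mat a11 a12 C A * (B @\<^sub>r D) = 0\<^sub>m 1 m @\<^sub>r 0\<^sub>m n m"
      by blast
    \<comment> \<open>\<open>zero_carrier_vec\<close> supplies the witness
      \<open>0\<^sub>v n\<close> for \<open>y\<close>.\<close>
    show ?thesis
      by (intro exI[of _ n] exI[of _ m] conjI nm bexI[OF _ *(1)] bexI[OF _ *(2)] bexI[of _ C] bexI[of _ D]
          bexI[OF _ *(3)] bexI[OF _ *(4)] bexI[OF _ zero_carrier_vec] bexI[OF _ car(2)] * IntI car)
  qed
  have 32: "?two" if ?three
    using that
  proof (elim exE conjE bexE IntE)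
    fix n m a11 a12 C D A B y z
    assume nm: "n > 0" "m > 0"
      and car: "a11 \<in> carrier_mat 1 n" "a12 \<in> carrier_mat 1 m" "C \<in> carrier_mat n n"
        "D \<in> carrier_mat m m" "C \<in> \<Sigma>" "D \<in> \<Sigma>" "A \<in> carrier_mat n m" "B \<in> carrier_mat n m"
        "y \<in> carrier_vec n" "z \<in> carrier_vec m"
      and rel: "vec 1 (\<lambda>_. x) @\<^sub>v 0\<^sub>v n = mat_act scale (four_block_mat a11 a12 C A) (y @\<^sub>v z)"
        "four_block_mat a11 a12 C A * (B @\<^sub>r D) = 0\<^sub>m 1 m @\<^sub>r 0\<^sub>m n m"
    \<comment> \<open>The common size is \<open>n + m\<close>, the size of the padded matrices built
      from \<open>C\<close> and \<open>D\<close>.\<close>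
    show ?two
      by (rule exI[of _ "n + m"], rule conjI[OF _ ge_if_relation[OF nm car rel]]) (simp add: nm)
  qed
  have 21: "x \<in> ker_mu scale \<Sigma>" if ?two
    using that unfolding ker_mu_iff_ge by blast
  show ?thesis
    by (rule conjI[OF iffI[OF 32[OF 13] 21] iffI[OF 13 21[OF 32]]])
qed

end
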